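(* Let $N\ge 1$ and $M$ be integers with $\gcd(M,N)=1$ and let $q=e^{2\pi i M/N}$. Let $a,b,c,d$ be nonzero complex numbers, put $g=abcd$, and suppose that none of $g, ab, ac, ad, bc, bd, cd$ is equal to $q^k$ for any $k\in\mathbb{Z}$. Put $$E_N=\frac{a^N+b^N+c^N+d^N-(abc)^N-(bcd)^N-(abd)^N-(acd)^N}{1-(abcd)^N},$$ suppose that $E_N\neq \pm 2$, and let $r$ be any one of the complex solutions of $r^N+r^{-N}=E_N$. Let $F_N(x)$ be the Askey-Wilson continued fraction (a rational function of $x$) $$F_N(x)=\cfrac{1}{x-v_0-\cfrac{u_1}{x-v_1-\cdots-\cfrac{u_{N-1}}{x-v_{N-1}}}},$$ with the coefficients $u_n, v_n$ defined in the context. Then, with $x=t+t^{-1}$, the rational function $F_N(x)$ has the representation $$F_N(x)=\frac{\kappa}{x-r-1/r}\;\frac{{}_9\varphi_8\left({q^{-(N-1)},\,rt,\,r/t,\,qr,\,-qr,\,ar,\,br,\,cr,\,dr \atop qr/t,\,qrt,\,r,\,-r,\,qr/a,\,qr/b,\,qr/c,\,qr/d};\,q,\,\frac{q^2}{g}\right)}{{}_4\varphi_3\left({q^{-(N-1)},\,gq^{-2},\,ar,\,a/r\atop ab,\,ac,\,ad};\,q,\,q\right)},$$ where $$\kappa=a^{N-1}\,\frac{(1-(bc)^N)(1-(cd)^N)(1-(bd)^N)(1-g/q)(1-g/q^2)(r-r^{-1})}{(1-g^N)^2(1-bc/q)(1-cd/q)(1-bd/q)(r^N-r^{-N})}.$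$
   Context: **Recurrence coefficients.** For integers $n\ge 0$, with $g=abcd$, $$\xi_n=\frac{a(1-q^n)(1-bcq^{n-1})(1-bdq^{n-1})(1-cdq^{n-1})}{(1-gq^{2n-2})(1-gq^{2n-1})},\qquad \eta_n=\frac{a^{-1}(1-abq^n)(1-acq^n)(1-adq^n)(1-gq^{n-1})}{(1-gq^{2n})(1-gq^{2n-1})},$$ $$u_n=\xi_n\eta_{n-1}\ (n\ge 1),\qquad v_n=a+a^{-1}-\xi_n-\eta_n\ (n\ge 0).$$ **Continued fraction.** Consider the three-term recurrence $X_{n+1}(x)+v_nX_n(x)+u_nX_{n-1}(x)=xX_n(x)$, $n\ge 1$. The initial conditions $X_0=1$, $X_1=x-v_0$ give the monic Askey-Wilson polynomials $P_n(x):=X_n(x)$, $n\ge 0$. The initial conditions $X_0^{(1)}=0$, $X_1^{(1)}=1$ give the associated Askey-Wilson polynomials $P_{n-1}^{(1)}(x):=X_n^{(1)}(x)$, $n\ge 1$. For $n\ge 1$, $$F_n(x)=\frac{P_{n-1}^{(1)}(x)}{P_n(x)},$$ which equals the finite continued fraction with partial denominators $x-v_0,\dots,x-v_{n-1}$ and subtracted partial numerators $u_1,\dots,u_{n-1}$ (so $F_1(x)=1/(x-v_0)$). **$q$-hypergeometric notation.** $(\alpha;q)_k=\prod_{m=0}^{k-1}(1-\alpha q^m)$, with $(\alpha;q)_0=1$. The terminating series with $q^{-(N-1)}$ as first upper parameter is the finite sum $${}_{s+1}\varphi_s\left({q^{-(N-1)},\alpha_1,\dots,\alpha_s\atop \beta_1,\dots,\beta_s};q,z\right)=\sum_{k=0}^{N-1}\frac{(q^{-(N-1)};q)_k(\alpha_1;q)_k\cdots(\alpha_s;q)_k}{(q;q)_k(\beta_1;q)_k\cdots(\beta_s;q)_k}\,z^k.$$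 *)

theory Defs
  imports Complex_Main "HOL-Computational_Algebra.Polynomial"
    "HOL-Computational_Algebra.Polynomial_Factorial"
begin

definition aw_xi :: "complex \<Rightarrow> complex \<Rightarrow> complex \<Rightarrow> complex \<Rightarrow> complex \<Rightarrow> nat \<Rightarrow> complex" where
  "aw_xi a b c d q n = (let g = a * b * c * d; k = int n in
     a * (1 - q powi k) * (1 - b * c * q powi (k - 1)) * (1 - b * d * q powi (k - 1))
       * (1 - c * d * q powi (k - 1))
     / ((1 - g * q powi (2 * k - 2)) * (1 - g * q powi (2 * k - 1))))"

definition aw_eta :: "complex \<Rightarrow> complex \<Rightarrow> complex \<Rightarrow> complex \<Rightarrow> complex \<Rightarrow> nat \<Rightarrow> complex" where
  "aw_eta a b c d q n = (let g = a * b * c * d; k = int n in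
     inverse a * (1 - a * b * q powi k) * (1 - a * c * q powi k) * (1 - a * d * q powi k)
       * (1 - g * q powi (k - 1))
     / ((1 - g * q powi (2 * k)) * (1 - g * q powi (2 * k - 1))))"

text \<open>The coefficient \<open>u\<^sub>n\<close> is only meaningful, and only used, for \<open>n \<ge> 1\<close>.\<close>

definition aw_u :: "complex \<Rightarrow> complex \<Rightarrow> complex \<Rightarrow> complex \<Rightarrow> complex \<Rightarrow> nat \<Rightarrow> complex" where
  "aw_u a b c d q n = aw_xi a b c d q n * aw_eta a b c d q (n - 1)"

definition aw_v :: "complex \<Rightarrow> complex \<Rightarrow> complex \<Rightarrow> complex \<Rightarrow> complex \<Rightarrow> nat \<Rightarrow> complex" where
  "aw_v a b c d q n = a + inverse a - aw_xi a b c d q n - aw_eta a b c d q n"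

definition aw_E :: "complex \<Rightarrow> complex \<Rightarrow> complex \<Rightarrow> complex \<Rightarrow> nat \<Rightarrow> complex" where
  "aw_E a b c d N =
     (a ^ N + b ^ N + c ^ N + d ^ N
        - (a * b * c) ^ N - (b * c * d) ^ N - (a * b * d) ^ N - (a * c * d) ^ N)
     / (1 - (a * b * c * d) ^ N)"

text \<open>\<open>cf_denom v u x m i\<close> is
  \<open>x - v\<^sub>i - u\<^sub>i\<^sub>+\<^sub>1/(x - v\<^sub>i\<^sub>+\<^sub>1 - \<dots> - u\<^sub>i\<^sub>+\<^sub>m/(x - v\<^sub>i\<^sub>+\<^sub>m))\<close>.\<close>

primrec cf_denom :: "(nat \<Rightarrow> 'a::field) \<Rightarrow> (nat \<Rightarrow> 'a) \<Rightarrow> 'a \<Rightarrow> nat \<Rightarrow> nat \<Rightarrow> 'a" where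
  "cf_denom v u x 0 i = x - v i"
| "cf_denom v u x (Suc m) i = x - v i - u (Suc i) / cf_denom v u x m (Suc i)"

text \<open>The \<open>N\<close>-th continued fraction; meant for \<open>N \<ge> 1\<close>.\<close>

definition cfrac :: "(nat \<Rightarrow> 'a::field) \<Rightarrow> (nat \<Rightarrow> 'a) \<Rightarrow> nat \<Rightarrow> 'a \<Rightarrow> 'a" where
  "cfrac v u N x = 1 / cf_denom v u x (N - 1) 0"

definition qpoch :: "'a::field \<Rightarrow> 'a \<Rightarrow> nat \<Rightarrow> 'a" where
  "qpoch \<alpha> q k = (\<Prod>m<k. 1 - \<alpha> * q ^ m)"

text \<open>The terminating basic hypergeometric series whose first upper parameter is
  \<open>q\<close> to the power \<open>-(N - 1)\<close>; \<open>as\<close> lists the remaining upper parameters and \<open>bs\<close> the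
  lower parameters.\<close>

definition qhyp_term :: "nat \<Rightarrow> 'a::field list \<Rightarrow> 'a list \<Rightarrow> 'a \<Rightarrow> 'a \<Rightarrow> 'a" where
  "qhyp_term N as bs q z =
     (\<Sum>k<N. qpoch (q powi (- (int N - 1))) q k * (\<Prod>\<alpha>\<leftarrow>as. qpoch \<alpha> q k)
            / (qpoch q q k * (\<Prod>\<beta>\<leftarrow>bs. qpoch \<beta> q k)) * z ^ k)"

text \<open>The field \<open>\<complex>(t)\<close> of rational functions: the embedded constants and the indeterminate \<open>t\<close>.
  Since \<open>t + 1/t\<close> is transcendental over \<open>\<complex>\<close>, substituting it for \<open>x\<close> embeds \<open>\<complex>(x)\<close>
  into \<open>\<complex>(t)\<close>, and no nonzero rational function of \<open>x\<close> vanishes there.\<close>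

definition rf_const :: "complex \<Rightarrow> complex poly fract" where
  "rf_const z = to_fract [:z:]"

definition rf_var :: "complex poly fract" where
  "rf_var = to_fract [:0, 1:]"

text \<open>The continued fraction with Askey-Wilson coefficients, as a rational function of \<open>x\<close>
  (evaluated at an element \<open>x\<close> of \<open>\<complex>(t)\<close>).\<close>

definition aw_F ::
  "complex \<Rightarrow> complex \<Rightarrow> complex \<Rightarrow> complex \<Rightarrow> complex \<Rightarrow> nat \<Rightarrow> complex poly fract \<Rightarrow> complex poly fract"
where
  "aw_F a b c d q N x =
     cfrac (\<lambda>n. rf_const (aw_v a b c d q n)) (\<lambda>n. rf_const (aw_u a b c d q n)) N x"

definition aw_kappa ::
  "complex \<Rightarrow> complex \<Rightarrow> complex \<Rightarrow> complex \<Rightarrow> complex \<Rightarrow> nat \<Rightarrow> complex \<Rightarrow> complex" where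
  "aw_kappa a b c d q N r = (let g = a * b * c * d in
     a ^ (N - 1)
     * ((1 - (b * c) ^ N) * (1 - (c * d) ^ N) * (1 - (b * d) ^ N) * (1 - g / q) * (1 - g / q\<^sup>2)
          * (r - inverse r))
     / ((1 - g ^ N)\<^sup>2 * (1 - b * c / q) * (1 - c * d / q) * (1 - b * d / q)
          * (r ^ N - inverse (r ^ N))))"

end

theory Submission
  imports Defs "HOL-Computational_Algebra.Fundamental_Theorem_Algebra"
begin

text \<open>
  Write \<open>P\<^sub>n\<close> for the monic Askey-Wilson polynomials, \<open>P\<^sup>1\<^sub>n\<close> for the associated ones, so that
  \<open>F\<^sub>N = P\<^sup>1\<^sub>N\<^sub>-\<^sub>1 / P\<^sub>N\<close>, and \<open>x\<^sub>s = r q\<^sup>s + 1/(r q\<^sup>s)\<close>. The formula is the partial fraction decomposition of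
  \<open>F\<^sub>N\<close>. In the \<open>\<^sub>9\<phi>\<^sub>8\<close> series the factors containing \<open>t\<close> telescope and its \<open>s\<close>-th term, multiplied by
  \<open>1/(x - r - 1/r)\<close>, becomes \<open>\<rho>\<^sub>s (r q\<^sup>s - 1/(r q\<^sup>s)) / ((r - 1/r) (x - x\<^sub>s))\<close> with explicit weights \<open>\<rho>\<^sub>s\<close>
  (lemma \<open>nine_phi_eight_term\<close>). So the poles and the residues of \<open>F\<^sub>N\<close> have to be found.

  Poles. For \<open>n < N\<close> the three-term recurrence is solved by \<open>\<^sub>4\<phi>\<^sub>3\<close> sums (\<open>X_hypergeometric\<close>). In the step to
  \<open>n = N\<close> all middle coefficients vanish because \<open>q\<^sup>N = 1\<close>, which leaves
  \<open>P\<^sub>N(z + 1/z) = z\<^sup>N + z\<^sup>-\<^sup>N - E\<^sub>N\<close> (\<open>X_N\<close>). Hence the zeros of \<open>P\<^sub>N\<close> are \<open>x\<^sub>0, \<dots>, x\<^sub>N\<^sub>-\<^sub>1\<close>; they are distinct, and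
  \<open>P\<^sub>N'(x\<^sub>s) = N (r\<^sup>N - r\<^sup>-\<^sup>N) / (r q\<^sup>s - 1/(r q\<^sup>s))\<close> (\<open>X_N_deriv_node\<close>).

  Residues. The Casorati determinant gives \<open>P\<^sup>1\<^sub>N\<^sub>-\<^sub>1(x\<^sub>s) P\<^sub>N\<^sub>-\<^sub>1(x\<^sub>s) = u\<^sub>1 \<cdots> u\<^sub>N\<^sub>-\<^sub>1\<close> (\<open>continuant_wronskian\<close>,
  \<open>numerator_at_node\<close>). It remains to see that \<open>P\<^sub>N\<^sub>-\<^sub>1(x\<^sub>s)\<close> is proportional to \<open>1/\<rho>\<^sub>s\<close>. The sequence \<open>\<rho>\<close> is
  periodic modulo \<open>N\<close> because \<open>r\<^sup>N + r\<^sup>-\<^sup>N = E\<^sub>N\<close> (\<open>rho_N\<close>), so \<open>1/\<rho>\<close> is a function on the nodes. A direct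
  computation shows that it is an eigenfunction of the Askey-Wilson difference operator with the
  eigenvalue \<open>(q - 1) (1 - g/q\<^sup>2)\<close> of degree \<open>N - 1\<close> (\<open>inverse_rho_eigen\<close>). This operator is bidiagonal in the
  basis \<open>(az;q)\<^sub>k (a/z;q)\<^sub>k\<close>, and its off-diagonal entries do not vanish for \<open>0 < k < N\<close>. Therefore an
  eigenvector is determined up to a scalar by its eigenvalue, and comparison of coefficients yields the
  \<open>\<^sub>4\<phi>\<^sub>3\<close> sum (\<open>expansion_coeff\<close>, \<open>penultimate_rho\<close>). The constant \<open>\<kappa>\<close> collects the remaining products
  (\<open>prod_xi_closed\<close>).
\<close>

section \<open>Continuants and partial fractions\<close>

text \<open>Determinant of the tridiagonal matrix of size \<open>m\<close> with diagonal entries \<open>x - v\<^sub>i, x - v\<^sub>i\<^sub>+\<^sub>1, \<dots>\<close>,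
  expanded along its first row, which is the direction in which a continued fraction unwinds.
  From \<open>i = 0\<close> it yields the monic orthogonal polynomials, from \<open>i = 1\<close> the associated ones.\<close>

fun continuant :: "(nat \<Rightarrow> 'a::comm_ring_1) \<Rightarrow> (nat \<Rightarrow> 'a) \<Rightarrow> 'a \<Rightarrow> nat \<Rightarrow> nat \<Rightarrow> 'a" where
  "continuant v u x 0 i = 1"
| "continuant v u x (Suc 0) i = x - v i"
| "continuant v u x (Suc (Suc m)) i =
     (x - v i) * continuant v u x (Suc m) (Suc i) - u (Suc i) * continuant v u x m (Suc (Suc i))"

lemma cf_denom_eq_continuant:
  fixes v u :: "nat \<Rightarrow> 'a::field"
  assumes "\<And>m i. continuant v u x m i \<noteq> 0"
  shows "cf_denom v u x m i = continuant v u x (Suc m) i / continuant v u x m (Suc i)"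
proof (induction m arbitrary: i)
  case (Suc m)
  have "cf_denom v u x (Suc m) i
      = (x - v i) - u (Suc i) * continuant v u x m (Suc (Suc i)) / continuant v u x (Suc m) (Suc i)"
    by (simp add: Suc)
  then show ?case
    using assms[of "Suc m" "Suc i"] by (simp add: divide_simps)
qed simp

text \<open>Expansion along the last row instead: this turns the continuants into solutions of the
  three-term recurrence.\<close>

lemma continuant_back:
  "continuant v u x (Suc (Suc m)) i =
     (x - v (i + m + 1)) * continuant v u x (Suc m) i - u (i + m + 1) * continuant v u x m i"
proof (induction m arbitrary: i rule: less_induct)
  case (less m)
  consider "m = 0" | "m = 1" | k where "m = Suc (Suc k)"
    by (metis One_nat_def not0_implies_Suc)
  then show ?case
  proof cases
    case 3
    have A: "continuant v u x (Suc (Suc (Suc k))) (Suc i) =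
       (x - v (i + m + 1)) * continuant v u x (Suc (Suc k)) (Suc i)
        - u (i + m + 1) * continuant v u x (Suc k) (Suc i)"
      using less[of "Suc k" "Suc i"] 3 by simp
    have B: "continuant v u x (Suc (Suc k)) (Suc (Suc i)) =
       (x - v (i + m + 1)) * continuant v u x (Suc k) (Suc (Suc i))
        - u (i + m + 1) * continuant v u x k (Suc (Suc i))"
      using less[of "k" "Suc (Suc i)"] 3 by simp
    have "continuant v u x (Suc (Suc m)) i = (x - v i) * continuant v u x (Suc (Suc (Suc k))) (Suc i)
       - u (Suc i) * continuant v u x (Suc (Suc k)) (Suc (Suc i))"
      unfolding 3 by (rule continuant.simps(3))
    moreover have "continuant v u x (Suc m) i = (x - v i) * continuant v u x (Suc (Suc k)) (Suc i)
       - u (Suc i) * continuant v u x (Suc k) (Suc (Suc i))"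
      unfolding 3 by (rule continuant.simps(3))
    moreover have "continuant v u x m i = (x - v i) * continuant v u x (Suc k) (Suc i)
       - u (Suc i) * continuant v u x k (Suc (Suc i))"
      unfolding 3 by (rule continuant.simps(3))
    ultimately have "continuant v u x (Suc (Suc m)) i =
        (x - v i) * ((x - v (i + m + 1)) * continuant v u x (Suc (Suc k)) (Suc i)
          - u (i + m + 1) * continuant v u x (Suc k) (Suc i))
        - u (Suc i) * ((x - v (i + m + 1)) * continuant v u x (Suc k) (Suc (Suc i))
          - u (i + m + 1) * continuant v u x k (Suc (Suc i)))"
      and E: "continuant v u x (Suc m) i = (x - v i) * continuant v u x (Suc (Suc k)) (Suc i)
          - u (Suc i) * continuant v u x (Suc k) (Suc (Suc i))"
        "continuant v u x m i = (x - v i) * continuant v u x (Suc k) (Suc i)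
          - u (Suc i) * continuant v u x k (Suc (Suc i))"
      unfolding A B by blast+
    then show ?thesis
      unfolding E by (simp only: algebra_simps)
  qed (simp_all add: algebra_simps)
qed

text \<open>The Casorati determinant of the two solutions. At a zero of the last continuant only the
  first product survives, so there the numerator of the continued fraction is, up to a known
  constant, the reciprocal of the penultimate orthogonal polynomial.\<close>

lemma continuant_wronskian:
  "continuant v u x (Suc n) 1 * continuant v u x (Suc n) 0 - continuant v u x n 1 * continuant v u x (Suc (Suc n)) 0
    = (\<Prod>j<Suc n. u (Suc j))"
proof (induction n)
  case 0
  then show ?case by (simp add: algebra_simps)
next
  case (Suc n)
  have A: "continuant v u x (Suc (Suc n)) 1
      = (x - v (n + 2)) * continuant v u x (Suc n) 1 - u (n + 2) * continuant v u x n 1"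
    using continuant_back[of v u x n 1] by (simp del: continuant.simps)
  have B: "continuant v u x (Suc (Suc (Suc n))) 0
      = (x - v (n + 2)) * continuant v u x (Suc (Suc n)) 0 - u (n + 2) * continuant v u x (Suc n) 0"
    using continuant_back[of v u x "Suc n" 0] by (simp del: continuant.simps)
  have "continuant v u x (Suc (Suc n)) 1 * continuant v u x (Suc (Suc n)) 0
        - continuant v u x (Suc n) 1 * continuant v u x (Suc (Suc (Suc n))) 0
      = u (n + 2) * (continuant v u x (Suc n) 1 * continuant v u x (Suc n) 0
        - continuant v u x n 1 * continuant v u x (Suc (Suc n)) 0)"
    unfolding A B by (simp only: algebra_simps)
  also have "\<dots> = u (n + 2) * (\<Prod>j<Suc n. u (Suc j))"
    by (simp only: Suc.IH)
  finally show ?case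
    by (simp add: mult.commute del: continuant.simps)
qed

lemma continuant_hom:
  fixes h :: "'a::comm_ring_1 \<Rightarrow> 'b::comm_ring_1"
  assumes "h 1 = 1" "\<And>y z. h (y * z) = h y * h z" "\<And>y z. h (y - z) = h y - h z"
  shows "h (continuant v u x m i) = continuant (\<lambda>n. h (v n)) (\<lambda>n. h (u n)) (h x) m i"
  by (induction v u x m i rule: continuant.induct) (simp_all add: assms)

abbreviation continuant_poly :: "(nat \<Rightarrow> complex) \<Rightarrow> (nat \<Rightarrow> complex) \<Rightarrow> nat \<Rightarrow> nat \<Rightarrow> complex poly" where
  "continuant_poly v u \<equiv> continuant (\<lambda>n. [:v n:]) (\<lambda>n. [:u n:]) [:0, 1:]"

lemma poly_continuant_poly: "poly (continuant_poly v u m i) y = continuant v u y m i"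
  by (subst continuant_hom[where h = "\<lambda>p. poly p y"]) simp_all

lemma continuant_poly_monic: "degree (continuant_poly v u m i) = m \<and> coeff (continuant_poly v u m i) m = 1"
proof (induction m arbitrary: i rule: less_induct)
  case (less m)
  consider "m = 0" | "m = 1" | k where "m = Suc (Suc k)"
    by (metis One_nat_def not0_implies_Suc)
  then show ?case
  proof cases
    case 3
    define P where "P = continuant_poly v u (Suc k) (Suc i)"
    define Q where "Q = continuant_poly v u k (Suc (Suc i))"
    have P: "degree P = Suc k" "coeff P (Suc k) = 1"
      using less[of "Suc k" "Suc i"] 3 by (auto simp: P_def)
    have Q: "degree Q = k"
      using less[of k "Suc (Suc i)"] 3 by (auto simp: Q_def)
    have eq: "continuant_poly v u m i = pCons 0 P - smult (v i) P - smult (u (Suc i)) Q"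
      by (simp add: 3 P_def Q_def algebra_simps)
    have "coeff (continuant_poly v u m i) m = 1"
      using P Q unfolding eq by (simp add: 3 coeff_eq_0)
    moreover have "degree (continuant_poly v u m i) \<le> m"
      unfolding eq using P Q
      by (intro degree_diff_le order_trans[OF degree_pCons_le] order_trans[OF degree_smult_le])
         (auto simp: 3)
    ultimately show ?thesis
      by (metis le_antisym le_degree zero_neq_one)
  qed (simp_all)
qed

lemma continuant_poly_nonzero: "continuant_poly v u m i \<noteq> 0"
  using continuant_poly_monic[of v u m i] by auto

text \<open>Lagrange interpolation serves twice: with prescribed values at the nodes, and as the partial
  fraction decomposition of a quotient with simple poles.\<close>

definition lagrange_poly :: "(nat \<Rightarrow> 'a::field) \<Rightarrow> nat \<Rightarrow> (nat \<Rightarrow> 'a) \<Rightarrow> 'a poly" where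
  "lagrange_poly y n f = (\<Sum>s<n. smult (f s / (\<Prod>j\<in>{..<n}-{s}. y s - y j))
                 (\<Prod>j\<in>{..<n}-{s}. [:- y j, 1:]))"

lemma degree_lagrange_poly:
  assumes "n > 0"
  shows "degree (lagrange_poly y n f) < n"
proof -
  have "degree (lagrange_poly y n f) \<le> n - 1"
    unfolding lagrange_poly_def
  proof (rule degree_sum_le)
    fix s assume s: "s \<in> {..<n}"
    have "degree (\<Prod>j\<in>{..<n}-{s}. [:- y j, 1:]) \<le> (\<Sum>j\<in>{..<n}-{s}. 1)"
      using degree_prod_sum_le[of "{..<n}-{s}" "\<lambda>j. [:- y j, 1:]"] by simp
    also have "\<dots> = n - 1" using s by simp
    finally show "degree (smult (f s / (\<Prod>j\<in>{..<n}-{s}. y s - y j))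
                 (\<Prod>j\<in>{..<n}-{s}. [:- y j, 1:])) \<le> n - 1"
      using degree_smult_le order_trans by blast
  qed simp
  then show ?thesis using assms by linarith
qed

lemma poly_lagrange_poly:
  assumes inj: "inj_on y {..<n}" and k: "k < n"
  shows "poly (lagrange_poly y n f) (y k) = f k"
proof -
  have "poly (lagrange_poly y n f) (y k) = (\<Sum>s<n. f s / (\<Prod>j\<in>{..<n}-{s}. y s - y j)
          * (\<Prod>j\<in>{..<n}-{s}. y k - y j))"
    by (simp add: lagrange_poly_def poly_sum poly_prod)
  also have "\<dots> = (\<Sum>s<n. if s = k then f k else 0)"
  proof (rule sum.cong[OF refl])
    fix s assume s: "s \<in> {..<n}"
    show "f s / (\<Prod>j\<in>{..<n}-{s}. y s - y j) * (\<Prod>j\<in>{..<n}-{s}. y k - y j)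
       = (if s = k then f k else 0)"
    proof (cases "s = k")
      case True
      have "y k - y j \<noteq> 0" if "j \<in> {..<n}-{k}" for j
        using inj that k by (auto simp: inj_on_def)
      then have "(\<Prod>j\<in>{..<n}-{k}. y k - y j) \<noteq> 0" by simp
      then show ?thesis using True by simp
    next
      case False
      then have "(\<Prod>j\<in>{..<n}-{s}. y k - y j) = 0"
        using k by (intro prod_zero) auto
      then show ?thesis using False by simp
    qed
  qed
  also have "\<dots> = f k" using k by simp
  finally show ?thesis .
qed

lemma lagrange_expansion:
  assumes inj: "inj_on y {..<n}" and deg: "degree p < n"
  shows "p = lagrange_poly y n (\<lambda>s. poly p (y s))"
proof (rule poly_eqI_degree[where A = "y ` {..<n}"])
  have "card (y ` {..<n}) = n" using inj by (simp add: card_image)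
  then show "card (y ` {..<n}) > degree p"
      "card (y ` {..<n}) > degree (lagrange_poly y n (\<lambda>s. poly p (y s)))"
    using deg degree_lagrange_poly[of n] by auto
qed (auto simp: poly_lagrange_poly[OF inj])

lemma monic_eq_prod_roots:
  fixes p :: "'a::field poly" and y :: "nat \<Rightarrow> 'a"
  assumes inj: "inj_on y {..<n}" and "degree p = n" "coeff p n = 1"
    and "\<And>s. s < n \<Longrightarrow> poly p (y s) = 0"
  shows "p = (\<Prod>j<n. [:- y j, 1:])"
proof (rule poly_eqI_degree_lead_coeff[where A = "y ` {..<n}" and n = n])
  have d: "degree (\<Prod>j<n. [:- y j, 1:]) = n"
    by (subst degree_prod_eq_sum_degree) auto
  have "lead_coeff (\<Prod>j<n. [:- y j, 1:]) = 1"
    by (subst lead_coeff_prod) simp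
  then show "coeff p n = coeff (\<Prod>j<n. [:- y j, 1:]) n"
    using assms d by simp
  show "degree (\<Prod>j<n. [:- y j, 1:]) \<le> n" using d by simp
  show "card (y ` {..<n}) \<ge> n" using inj by (simp add: card_image)
  show "degree p \<le> n" using assms by simp
  fix z assume "z \<in> y ` {..<n}"
  then show "poly p z = poly (\<Prod>j<n. [:- y j, 1:]) z"
    using assms by (auto simp: poly_prod intro!: prod_zero)
qed

lemma poly_pderiv_prod_roots:
  fixes y :: "nat \<Rightarrow> 'a::field"
  assumes "s < n"
  shows "poly (pderiv (\<Prod>j<n. [:- y j, 1:])) (y s) = (\<Prod>j\<in>{..<n}-{s}. y s - y j)"
proof -
  have "(\<Prod>j<n. [:- y j, 1:]) = [:- y s, 1:] * (\<Prod>j\<in>{..<n}-{s}. [:- y j, 1:])"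
    using assms by (subst prod.remove[of _ s]) auto
  then show ?thesis
    by (simp only: pderiv_mult) (simp add: poly_prod pderiv_pCons)
qed

section \<open>Rational functions of \<open>t + 1/t\<close>\<close>

lemma rf_const_0 [simp]: "rf_const 0 = 0"
  and rf_const_1 [simp]: "rf_const 1 = 1"
  by (simp_all add: rf_const_def pCons_one)

lemma rf_const_diff [simp]: "rf_const (y - z) = rf_const y - rf_const z"
  and rf_const_add [simp]: "rf_const (y + z) = rf_const y + rf_const z"
  and rf_const_uminus [simp]: "rf_const (- y) = - rf_const y"
  and rf_const_mult [simp]: "rf_const (y * z) = rf_const y * rf_const z"
  by (simp_all add: rf_const_def flip: to_fract_diff to_fract_add to_fract_mult to_fract_uminus)

lemma rf_const_eq_iff [simp]: "rf_const y = rf_const z \<longleftrightarrow> y = z"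
  by (simp add: rf_const_def)

lemma rf_const_eq_0_iff [simp]: "rf_const y = 0 \<longleftrightarrow> y = 0"
  by (metis rf_const_0 rf_const_eq_iff)

lemma rf_const_inverse [simp]: "rf_const (inverse y) = inverse (rf_const y)"
proof (cases "y = 0")
  case False
  then have "rf_const y * rf_const (inverse y) = 1"
    by (simp flip: rf_const_mult)
  then show ?thesis by (metis inverse_unique)
qed simp

lemma rf_const_divide [simp]: "rf_const (y / z) = rf_const y / rf_const z"
  by (simp add: divide_inverse)

lemma rf_const_power [simp]: "rf_const (y ^ n) = rf_const y ^ n"
  by (induction n) simp_all

lemma rf_const_prod: "rf_const (prod f A) = (\<Prod>i\<in>A. rf_const (f i))"
  by (induction A rule: infinite_finite_induct) simp_all

lemma rf_const_qpoch: "qpoch (rf_const y) (rf_const q) k = rf_const (qpoch y q k)"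
  by (simp add: qpoch_def rf_const_prod)

lemma rf_affine_nonzero:
  assumes "y \<noteq> 0"
  shows "1 - rf_const y * rf_var \<noteq> 0" "1 - rf_const y / rf_var \<noteq> 0"
proof -
  have v: "rf_var \<noteq> 0" by (simp add: rf_var_def)
  have "1 - rf_const y * rf_var = to_fract [:1, - y:]"
    by (simp add: rf_const_def rf_var_def flip: to_fract_1 to_fract_mult to_fract_diff)
       (simp add: one_pCons)
  then show "1 - rf_const y * rf_var \<noteq> 0" by simp
  have "(1 - rf_const y / rf_var) * rf_var = rf_var - rf_const y"
    using v by (simp add: field_simps)
  also have "\<dots> = to_fract [:- y, 1:]"
    by (simp add: rf_const_def rf_var_def flip: to_fract_diff)
  finally show "1 - rf_const y / rf_var \<noteq> 0" by (auto simp del: to_fract_diff)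
qed

text \<open>Substitution of \<open>x = t + 1/t\<close> into a polynomial. It is a ring homomorphism, and it is injective
  because a polynomial over the complex numbers splits into linear factors, none of which
  vanishes at \<open>t + 1/t\<close>.\<close>

definition rf_eval :: "complex poly \<Rightarrow> complex poly fract" where
  "rf_eval p = poly (map_poly rf_const p) (rf_var + inverse rf_var)"

lemma rf_eval_pCons [simp]:
  "rf_eval (pCons y p) = rf_const y + (rf_var + inverse rf_var) * rf_eval p"
  by (simp add: rf_eval_def map_poly_pCons)

lemma rf_eval_0 [simp]: "rf_eval 0 = 0"
  by (simp add: rf_eval_def)

lemma rf_eval_1 [simp]: "rf_eval 1 = 1"
  by (simp add: one_pCons)

lemma rf_eval_add [simp]: "rf_eval (p + q) = rf_eval p + rf_eval q"
  by (induction p q rule: poly_induct2) (simp_all add: algebra_simps)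

lemma rf_eval_diff [simp]: "rf_eval (p - q) = rf_eval p - rf_eval q"
  using rf_eval_add[of "p - q" q] by (simp del: rf_eval_add)

lemma rf_eval_smult [simp]: "rf_eval (smult y p) = rf_const y * rf_eval p"
  by (induction p) (simp_all add: algebra_simps)

lemma rf_eval_mult [simp]: "rf_eval (p * q) = rf_eval p * rf_eval q"
  by (induction p) (simp_all add: algebra_simps)

lemma rf_eval_sum: "rf_eval (sum f A) = (\<Sum>i\<in>A. rf_eval (f i))"
  by (induction A rule: infinite_finite_induct) simp_all

lemma rf_eval_prod: "rf_eval (prod f A) = (\<Prod>i\<in>A. rf_eval (f i))"
  by (induction A rule: infinite_finite_induct) simp_all

lemma rf_joukowski_nonconstant: "rf_var + inverse rf_var - rf_const z \<noteq> 0"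
proof
  assume eq: "rf_var + inverse rf_var - rf_const z = 0"
  have v: "rf_var \<noteq> 0" by (simp add: rf_var_def)
  have "to_fract [:1, - z, 1:] = to_fract ([:0,1:] * [:0,1:] + 1 - [:z:] * [:0,1:])"
    by (rule arg_cong[where f = to_fract]) (simp add: one_pCons)
  also have "\<dots> = rf_var * rf_var + 1 - rf_const z * rf_var"
    unfolding to_fract_diff to_fract_add to_fract_mult to_fract_1 rf_var_def rf_const_def ..
  also have "\<dots> = (rf_var + inverse rf_var - rf_const z) * rf_var"
    using v by (simp add: field_simps)
  finally show False using eq by simp
qed

lemma rf_eval_nonzero:
  assumes "p \<noteq> 0"
  shows "rf_eval p \<noteq> 0"
  using assms
proof (induction "degree p" arbitrary: p rule: less_induct)
  case less
  show ?case
  proof (cases "degree p = 0")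
    case True
    then obtain y where "p = [:y:]" by (auto elim: degree_eq_zeroE)
    then show ?thesis using less.prems by simp
  next
    case False
    then obtain z where "poly p z = 0"
      using fundamental_theorem_of_algebra[of p] by (auto simp: constant_degree)
    then obtain s where s: "p = [:- z, 1:] * s"
      by (auto simp: poly_eq_0_iff_dvd dvd_def)
    with less.prems have "s \<noteq> 0" by auto
    then have "degree s < degree p" unfolding s by (simp add: degree_mult_eq del: mult_pCons_left)
    with less.hyps \<open>s \<noteq> 0\<close> have "rf_eval s \<noteq> 0" by blast
    moreover have "rf_eval p = (rf_var + inverse rf_var - rf_const z) * rf_eval s"
      unfolding s rf_eval_mult by simp
    ultimately show ?thesis using rf_joukowski_nonconstant by simp
  qed
qed

text \<open>If the last monic polynomial has \<open>N\<close> distinct zeros, the continued fraction is a sum of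
  simple poles. No division in the continued fraction degenerates, since every denominator is
  the image of a monic polynomial.\<close>

lemma cfrac_partial_fractions:
  fixes v u :: "nat \<Rightarrow> complex" and y :: "nat \<Rightarrow> complex"
  assumes N: "N \<ge> 1" and inj: "inj_on y {..<N}"
    and root: "\<And>s. s < N \<Longrightarrow> continuant v u (y s) N 0 = 0"
  shows "cfrac (\<lambda>n. rf_const (v n)) (\<lambda>n. rf_const (u n)) N (rf_var + inverse rf_var)
    = (\<Sum>s<N. rf_const (continuant v u (y s) (N - 1) 1 / poly (pderiv (continuant_poly v u N 0)) (y s))
              / (rf_var + inverse rf_var - rf_const (y s)))"
proof -
  let ?x = "rf_var + inverse rf_var"
  have ev: "rf_eval (continuant_poly v u m i) = continuant (\<lambda>n. rf_const (v n)) (\<lambda>n. rf_const (u n)) ?x m i" for m i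
    by (subst continuant_hom[where h = rf_eval]) simp_all
  have nz: "continuant (\<lambda>n. rf_const (v n)) (\<lambda>n. rf_const (u n)) ?x m i \<noteq> 0" for m i
    using rf_eval_nonzero[OF continuant_poly_nonzero] by (simp flip: ev)
  have prodP: "continuant_poly v u N 0 = (\<Prod>j<N. [:- y j, 1:])"
    using continuant_poly_monic[of v u N 0] root by (intro monic_eq_prod_roots inj) (auto simp: poly_continuant_poly)
  let ?w = "\<lambda>s. continuant v u (y s) (N - 1) 1 / poly (pderiv (continuant_poly v u N 0)) (y s)"
  have "continuant_poly v u (N - 1) 1 = (\<Sum>s<N. smult (?w s) (\<Prod>j\<in>{..<N}-{s}. [:- y j, 1:]))"
  proof -
    have "degree (continuant_poly v u (N - 1) 1) < N"
      using continuant_poly_monic[of v u "N - 1" 1] N by simp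
    from lagrange_expansion[OF inj this] show ?thesis
      unfolding lagrange_poly_def
      by (rule trans) (intro sum.cong refl, simp add: poly_continuant_poly prodP poly_pderiv_prod_roots)
  qed
  then have "rf_eval (continuant_poly v u (N - 1) 1)
      = (\<Sum>s<N. rf_const (?w s) * (\<Prod>j\<in>{..<N}-{s}. ?x - rf_const (y j)))"
    by (simp add: rf_eval_sum rf_eval_prod)
  also have "\<dots> = (\<Sum>s<N. rf_const (?w s) / (?x - rf_const (y s))) * (\<Prod>j<N. ?x - rf_const (y j))"
    unfolding sum_distrib_right
  proof (rule sum.cong[OF refl])
    fix s assume "s \<in> {..<N}"
    then have "(\<Prod>j<N. ?x - rf_const (y j))
       = (?x - rf_const (y s)) * (\<Prod>j\<in>{..<N}-{s}. ?x - rf_const (y j))"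
      by (subst prod.remove[of _ s]) auto
    then show "rf_const (?w s) * (\<Prod>j\<in>{..<N}-{s}. ?x - rf_const (y j))
      = rf_const (?w s) / (?x - rf_const (y s)) * (\<Prod>j<N. ?x - rf_const (y j))"
      using rf_joukowski_nonconstant[of "y s"] by simp
  qed
  also have "(\<Prod>j<N. ?x - rf_const (y j)) = rf_eval (continuant_poly v u N 0)"
    unfolding prodP by (simp add: rf_eval_prod)
  finally have "rf_eval (continuant_poly v u (N - 1) 1) / rf_eval (continuant_poly v u N 0)
     = (\<Sum>s<N. rf_const (?w s) / (?x - rf_const (y s)))"
    using rf_eval_nonzero[OF continuant_poly_nonzero[of v u N 0]] by (simp add: divide_simps)
  moreover have "cfrac (\<lambda>n. rf_const (v n)) (\<lambda>n. rf_const (u n)) N ?x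
     = rf_eval (continuant_poly v u (N - 1) 1) / rf_eval (continuant_poly v u N 0)"
    using N by (simp add: cfrac_def cf_denom_eq_continuant[OF nz] ev)
  ultimately show ?thesis by simp
qed

section \<open>Shifted factorials at a primitive root of unity\<close>

lemma qpoch_0 [simp]: "qpoch y q 0 = 1"
  by (simp add: qpoch_def)

lemma qpoch_Suc: "qpoch y q (Suc k) = qpoch y q k * (1 - y * q ^ k)"
  by (simp add: qpoch_def)

lemma qpoch_rec: "qpoch y q (Suc k) = (1 - y) * qpoch (y * q) q k"
  unfolding qpoch_def by (subst prod.lessThan_Suc_shift) (simp add: mult.assoc)

lemma qpoch_add: "qpoch y q (m + k) = qpoch y q m * qpoch (y * q ^ m) q k"
  by (induction k) (simp_all add: qpoch_Suc power_add mult.assoc)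

lemma qpoch_eq_0_iff: "qpoch y q k = 0 \<longleftrightarrow> (\<exists>j<k. y * q ^ j = 1)"
  by (auto simp: qpoch_def)

locale primitive_root =
  fixes N :: nat and q :: complex
  assumes N_pos: "N \<ge> 1" and q_N: "q ^ N = 1"
    and q_prim: "\<And>k. 0 < k \<Longrightarrow> k < N \<Longrightarrow> q ^ k \<noteq> 1"
begin

lemma q_nonzero [simp]: "q \<noteq> 0"
proof
  assume "q = 0"
  then show False using q_N N_pos by (cases N) auto
qed

lemma q_pow_N: "(q ^ k) ^ N = 1"
  by (metis mult.commute power_mult power_one q_N)

lemma q_pow_pred: "q ^ (N - 1) = 1 / q"
  using q_N N_pos by (cases N) (auto simp: field_simps)

lemma inj_q_pow: "inj_on (\<lambda>k. q ^ k) {..<N}"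
proof -
  have "q ^ i \<noteq> q ^ j" if "i < j" "j < N" for i j
  proof
    assume "q ^ i = q ^ j"
    moreover have "q ^ j = q ^ i * q ^ (j - i)" using that by (simp flip: power_add)
    ultimately have "q ^ i * q ^ (j - i) = q ^ i" by simp
    then show False using q_prim[of "j - i"] that by simp
  qed
  then show ?thesis by (metis inj_onI lessThan_iff linorder_neqE_nat)
qed

text \<open>Both sides have degree at most \<open>N\<close> in \<open>y\<close> and agree at \<open>y = 0\<close> and at the \<open>N\<close> roots of unity.\<close>

lemma qpoch_N: "qpoch y q N = 1 - y ^ N"
proof -
  let ?P = "\<Prod>m<N. [:1, - (q ^ m):]" and ?Q = "[:1:] - monom 1 N :: complex poly"
  have "?P = ?Q"
  proof (rule poly_eqI_degree[where A = "insert 0 ((\<lambda>k. q ^ k) ` {..<N})"])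
    have card: "card (insert 0 ((\<lambda>k. q ^ k) ` {..<N})) = Suc N"
      using inj_q_pow by (subst card_insert_disjoint) (auto simp: card_image)
    have "degree ?P \<le> (\<Sum>m<N. 1)"
      by (rule order_trans[OF degree_prod_sum_le]) (auto intro!: sum_mono)
    then show "card (insert 0 ((\<lambda>k. q ^ k) ` {..<N})) > degree ?P" using card by simp
    have "degree ?Q \<le> N" by (intro degree_diff_le) (auto simp: degree_monom_le)
    then show "card (insert 0 ((\<lambda>k. q ^ k) ` {..<N})) > degree ?Q" using card by simp
    fix z assume "z \<in> insert 0 ((\<lambda>k. q ^ k) ` {..<N})"
    then consider "z = 0" | k where "k < N" "z = q ^ k" by auto
    then show "poly ?P z = poly ?Q z"
    proof cases
      case 1
      then show ?thesis using N_pos by (simp add: poly_prod poly_monom)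
    next
      case (2 k)
      have "\<exists>j<N. q ^ k * q ^ j = 1"
      proof (cases "k = 0")
        case True
        then show ?thesis using N_pos by (intro exI[of _ 0]) simp
      next
        case False
        then show ?thesis using 2 q_N by (intro exI[of _ "N - k"]) (simp flip: power_add)
      qed
      then have "poly ?P z = 0"
        using 2 by (auto simp: poly_prod)
      then show ?thesis using 2 q_pow_N by (simp add: poly_monom)
    qed
  qed
  then have "poly ?P y = poly ?Q y" by simp
  then show ?thesis by (simp add: qpoch_def poly_prod poly_monom)
qed

text \<open>The previous identity divided by \<open>1 - y\<close> and evaluated at \<open>y = 1\<close>; the division is
  done in the polynomial ring.\<close>

lemma qpoch_q_pred: "qpoch q q (N - 1) = of_nat N"
proof -
  let ?P = "\<Prod>m<N-1. [:1, - (q ^ Suc m):]" and ?Q = "\<Sum>m<N. monom 1 m :: complex poly"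
  have "poly ([:1, -1:] * ?P) y = poly ([:1, -1:] * ?Q) y" for y
  proof -
    have "poly ([:1, -1:] * ?P) y = (1 - y) * qpoch (y * q) q (N - 1)"
      by (simp only: poly_mult poly_prod qpoch_def) (simp add: mult.assoc)
    also have "\<dots> = 1 - y ^ N"
      using qpoch_rec[of y q "N - 1"] qpoch_N[of y] N_pos by simp
    also have "\<dots> = (1 - y) * (\<Sum>m<N. y ^ m)"
      by (rule one_diff_power_eq)
    finally show ?thesis by (simp only: poly_mult) (simp add: poly_sum poly_monom)
  qed
  then have "[:1, -1:] * ?P = [:1, -1:] * ?Q" using poly_eq_poly_eq_iff by blast
  then have "?P = ?Q" by (subst (asm) mult_cancel_left) simp
  then have "poly ?P 1 = poly ?Q 1" by simp
  then show ?thesis by (simp add: qpoch_def poly_prod poly_sum poly_monom)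
qed

lemma one_minus_nonzero: "(y::complex) ^ N \<noteq> 1 \<Longrightarrow> w ^ N = 1 \<Longrightarrow> 1 - y * w \<noteq> 0"
proof
  assume y: "y ^ N \<noteq> 1" and w: "w ^ N = 1" and "1 - y * w = 0"
  then have "1 = y * w" by (simp only: right_minus_eq)
  then have "(y * w) ^ N = 1" by (metis power_one)
  then show False using y w by (simp add: power_mult_distrib)
qed

lemma qpoch_nonzero:
  assumes "y ^ N \<noteq> 1"
  shows "qpoch y q k \<noteq> 0"
  unfolding qpoch_eq_0_iff using one_minus_nonzero[OF assms q_pow_N] by fastforce

lemma qpoch_q_nonzero: "k < N \<Longrightarrow> qpoch q q k \<noteq> 0"
  unfolding qpoch_eq_0_iff power_Suc[symmetric]
  by (meson Suc_leI le_less_trans q_prim zero_less_Suc)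

end

lemma powi_double: "(q::complex) powi (2 * int n) = (q ^ n)\<^sup>2"
proof -
  have "q powi (2 * int n) = q powi (int (2 * n))" by simp
  also have "\<dots> = (q ^ n)\<^sup>2"
    by (simp only: power_int_of_nat power_even_eq)
  finally show ?thesis .
qed

lemma aw_xi_eq:
  assumes "q \<noteq> 0"
  shows "aw_xi a b c d q n = a * (1 - q^n) * (1 - b * c * q^n / q) * (1 - b * d * q^n / q)
     * (1 - c * d * q^n / q)
     / ((1 - a * b * c * d * (q^n)\<^sup>2 / q\<^sup>2) * (1 - a * b * c * d * (q^n)\<^sup>2 / q))"
proof -
  have "q powi (int n - 1) = q^n / q" using assms by (simp add: power_int_diff)
  moreover have "q powi (2 * int n - 2) = (q^n)\<^sup>2 / q\<^sup>2"
    using assms by (simp add: power_int_diff powi_double)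
  moreover have "q powi (2 * int n - 1) = (q^n)\<^sup>2 / q"
    using assms by (simp add: power_int_diff powi_double)
  ultimately show ?thesis by (simp add: aw_xi_def Let_def)
qed

lemma aw_eta_eq:
  assumes "q \<noteq> 0"
  shows "aw_eta a b c d q n = (1 - a * b * q^n) * (1 - a * c * q^n) * (1 - a * d * q^n)
     * (1 - a * b * c * d * q^n / q)
     / (a * (1 - a * b * c * d * (q^n)\<^sup>2) * (1 - a * b * c * d * (q^n)\<^sup>2 / q))"
proof -
  have "q powi (int n - 1) = q^n / q" using assms by (simp add: power_int_diff)
  moreover have "q powi (2 * int n) = (q^n)\<^sup>2"
    by (rule powi_double)
  moreover have "q powi (2 * int n - 1) = (q^n)\<^sup>2 / q"
    using assms by (simp add: power_int_diff powi_double)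
  ultimately show ?thesis
    by (simp only: aw_eta_def Let_def times_divide_eq_right power_int_of_nat)
       (simp only: divide_inverse inverse_mult_distrib mult_ac)
qed

lemma prod_aw_eta:
  assumes "q \<noteq> 0"
  shows "(\<Prod>j<n. aw_eta a b c d q j) = qpoch (a * b) q n * qpoch (a * c) q n * qpoch (a * d) q n
     * qpoch (a * b * c * d / q) q n / (a ^ n * qpoch (a * b * c * d / q) q (2 * n))"
proof (induction n)
  case (Suc n)
  have "qpoch (a * b * c * d / q) q (2 * Suc n) = qpoch (a * b * c * d / q) q (2 * n)
     * (1 - a * b * c * d * (q^n)\<^sup>2 / q) * (1 - a * b * c * d * (q^n)\<^sup>2)"
    using assms by (simp add: qpoch_Suc mult_2 power_add power2_eq_square)
  then show ?case 
    unfolding prod.lessThan_Suc Suc.IH aw_eta_eq[OF assms, of _ _ _ _ n]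
    by (simp only: times_divide_times_eq times_divide_eq_left times_divide_eq_right
        divide_divide_eq_left qpoch_Suc power_Suc mult_ac)
qed simp

lemma prod_aw_xi:
  assumes "q \<noteq> 0"
  shows "(\<Prod>j<n. aw_xi a b c d q (Suc j)) = a ^ n * qpoch q q n * qpoch (b * c) q n
     * qpoch (b * d) q n * qpoch (c * d) q n / qpoch (a * b * c * d) q (2 * n)"
proof (induction n)
  case (Suc n)
  have "qpoch (a * b * c * d) q (2 * Suc n) = qpoch (a * b * c * d) q (2 * n)
     * (1 - a * b * c * d * (q ^ Suc n)\<^sup>2 / q\<^sup>2) * (1 - a * b * c * d * (q^Suc n)\<^sup>2 / q)"
  proof -
    have "y * (q ^ Suc n)\<^sup>2 / q\<^sup>2 = y * q ^ (2 * n)" "y * (q ^ Suc n)\<^sup>2 / q = y * q ^ Suc (2 * n)" for y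
      using assms by (simp_all add: mult_2 power_add power2_eq_square)
    then show ?thesis by (simp add: qpoch_Suc)
  qed
  moreover have "aw_xi a b c d q (Suc n) = a * (1 - q ^ Suc n) * (1 - b * c * q^n) * (1 - b * d * q^n)
     * (1 - c * d * q^n)
     / ((1 - a * b * c * d * (q^Suc n)\<^sup>2 / q\<^sup>2) * (1 - a * b * c * d * (q^Suc n)\<^sup>2 / q))"
  proof -
    have "y * q ^ Suc n / q = y * q ^ n" for y
      using assms by simp
    then show ?thesis by (simp only: aw_xi_eq[OF assms])
  qed
  ultimately show ?case 
    unfolding prod.lessThan_Suc Suc.IH
    by (simp only: times_divide_times_eq qpoch_Suc power_Suc mult_ac)
qed simp

section \<open>The three-term recurrence of the hypergeometric sums\<close>

text \<open>The Newton-type basis of Askey and Wilson: up to constants, the Newton polynomials in \<open>z + 1/z\<close>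
  for the interpolation points \<open>a q\<^sup>j + 1/(a q\<^sup>j)\<close>. Multiplication by \<open>z + 1/z\<close> is bidiagonal in it.\<close>

definition aw_basis :: "complex \<Rightarrow> complex \<Rightarrow> complex \<Rightarrow> nat \<Rightarrow> complex" where
  "aw_basis a q z k = qpoch (a * z) q k * qpoch (a / z) q k"

lemma aw_basis_0 [simp]: "aw_basis a q z 0 = 1"
  by (simp add: aw_basis_def)

lemma aw_basis_Suc:
  assumes "z \<noteq> 0"
  shows "aw_basis a q z (Suc k) = (1 + (a * q ^ k)\<^sup>2 - a * q ^ k * (z + inverse z)) * aw_basis a q z k"
  using assms by (simp add: aw_basis_def qpoch_Suc field_simps power2_eq_square)

text \<open>The \<open>\<^sub>4\<phi>\<^sub>3\<close> coefficients of the polynomial of degree \<open>n\<close> for \<open>Q = q\<^sup>n\<close>. Keeping \<open>Q\<close> as a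
  variable lets the neighbouring degrees be \<open>Q q\<close> and \<open>Q / q\<close>, also for \<open>n = 0\<close>.\<close>

definition aw_coeff ::
  "complex \<Rightarrow> complex \<Rightarrow> complex \<Rightarrow> complex \<Rightarrow> complex \<Rightarrow> complex \<Rightarrow> nat \<Rightarrow> complex" where
  "aw_coeff a b c d q Q k = qpoch (1 / Q) q k * qpoch (a * b * c * d * Q / q) q k * q ^ k
     / (qpoch (a * b) q k * qpoch (a * c) q k * qpoch (a * d) q k * qpoch q q k)"

lemma aw_coeff_0 [simp]: "aw_coeff a b c d q Q 0 = 1"
  by (simp add: aw_coeff_def)

text \<open>The difference of two neighbouring coefficients factors, and its factor \<open>1 - g Q\<^sup>2\<close> cancels a
  denominator of the recurrence coefficients.\<close>

lemma qpoch_shift_diff: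
  fixes q :: complex
  assumes "q \<noteq> 0" "Q \<noteq> 0"
  shows "qpoch (1 / (Q * q)) q (Suc k) * qpoch (g * Q) q (Suc k)
      - qpoch (1 / Q) q (Suc k) * qpoch (g * Q / q) q (Suc k)
    = - (1 - q ^ Suc k) / (Q * q) * (1 - g * Q\<^sup>2) * (qpoch (1 / Q) q k * qpoch (g * Q) q k)"
proof -
  have "qpoch (1 / (Q * q)) q (Suc k) = (1 - 1 / (Q * q)) * qpoch (1 / Q) q k"
    using assms by (simp add: qpoch_rec)
  moreover have "qpoch (g * Q / q) q (Suc k) = (1 - g * Q / q) * qpoch (g * Q) q k"
    using assms by (simp add: qpoch_rec)
  moreover have "(1 - 1 / (Q * q)) * (1 - g * Q * q ^ k) - (1 - q ^ k / Q) * (1 - g * Q / q)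
     = - (1 - q ^ Suc k) / (Q * q) * (1 - g * Q\<^sup>2)"
    using assms by (simp add: field_simps power2_eq_square)
  moreover have "(x * u) * (v * y) - (u * z) * (w * v) = (x * y - z * w) * (u * v)"
    for x y z u v w :: complex by (simp add: algebra_simps)
  ultimately show ?thesis by (simp add: qpoch_Suc)
qed

text \<open>What remains of the three-term recurrence for one coefficient once all shifted factorials
  have been divided out.\<close>

lemma aw_core_identity:
  fixes a b c d q Q K :: complex
  assumes nz: "a \<noteq> 0" "q \<noteq> 0" "Q \<noteq> 0" "K \<noteq> 0"
  shows "(1 - a * b * Q) * (1 - a * c * Q) * (1 - a * d * Q) * (1 - a * b * c * d * Q * K / q) / (a * Q * q)
      + a * (1 - b * c * Q / q) * (1 - b * d * Q / q) * (1 - c * d * Q / q) * (1 - K / Q)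
    = (1 - a * b * c * d * Q\<^sup>2 / q) * ((a - 1 / (a * K * q)) * (1 - K / Q) * (1 - a * b * c * d * Q * K / q)
        + (1 - a * b * K) * (1 - a * c * K) * (1 - a * d * K) / (a * K * q))"
proof -
  \<comment> \<open>Reciprocals become variables with relations, so that the claim is an ideal membership.\<close>
  define x where "x = inverse q"
  define y where "y = inverse Q"
  define w where "w = inverse K"
  define e where "e = inverse a"
  have r: "q * x = 1" "Q * y = 1" "K * w = 1" "a * e = 1"
    using nz by (simp_all add: x_def y_def w_def e_def)
  have "(1 - a * b * Q) * (1 - a * c * Q) * (1 - a * d * Q) * (1 - a * b * c * d * Q * K * x) * (e * y * x)
      + a * (1 - b * c * Q * x) * (1 - b * d * Q * x) * (1 - c * d * Q * x) * (1 - K * y)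
    = (1 - a * b * c * d * Q\<^sup>2 * x) * ((a - e * w * x) * (1 - K * y) * (1 - a * b * c * d * Q * K * x)
        + (1 - a * b * K) * (1 - a * c * K) * (1 - a * d * K) * (e * w * x))"
    using r by algebra
  then show ?thesis
    by (simp add: x_def y_def w_def e_def field_class.field_divide_inverse)
qed

lemma aw_coeff_recurrence:
  fixes a b c d q :: complex and n k :: nat
  defines "Q \<equiv> q ^ n" and "K \<equiv> q ^ k" and "g \<equiv> a * b * c * d"
  assumes nz: "a \<noteq> 0" "q \<noteq> 0"
    and g: "1 - g * Q\<^sup>2 \<noteq> 0" "1 - g * Q\<^sup>2 / q \<noteq> 0" "1 - g * Q\<^sup>2 / q\<^sup>2 \<noteq> 0"
    and fac: "1 - a * b * K \<noteq> 0" "1 - a * c * K \<noteq> 0" "1 - a * d * K \<noteq> 0" "1 - K * q \<noteq> 0"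
  shows "aw_eta a b c d q n * (aw_coeff a b c d q (Q * q) (Suc k) - aw_coeff a b c d q Q (Suc k))
      + aw_xi a b c d q n * (aw_coeff a b c d q (Q / q) (Suc k) - aw_coeff a b c d q Q (Suc k))
    = (a * K * q + 1 / (a * K * q) - a - 1 / a) * aw_coeff a b c d q Q (Suc k)
      - aw_coeff a b c d q Q k / (a * K)"
proof -
  have nz': "Q \<noteq> 0" "K \<noteq> 0" using nz by (simp_all add: Q_def K_def)
  define U where "U = qpoch (1 / Q) q k"
  define V where "V = qpoch (g * Q / q) q k"
  define W where "W = qpoch (g * Q) q k"
  define Y where "Y = qpoch (1 / (Q / q)) q k"
  define E where "E = qpoch (a * b) q k * qpoch (a * c) q k * qpoch (a * d) q k * qpoch q q k"
  define F where "F = (1 - a * b * K) * (1 - a * c * K) * (1 - a * d * K)"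
  define E' where "E' = E * F * (1 - K * q)"
  define S where "S = - (1 - K * q) * (K * q) * U * V / E'"
  have F: "F \<noteq> 0" "1 - K * q \<noteq> 0" using fac by (simp_all add: F_def)
  have E'_eq: "qpoch (a * b) q (Suc k) * qpoch (a * c) q (Suc k) * qpoch (a * d) q (Suc k) * qpoch q q (Suc k) = E'"
    by (simp add: E'_def E_def F_def qpoch_Suc K_def mult_ac)
  have W: "(1 - g * Q / q) * W = V * (1 - g * Q * K / q)"
    using qpoch_rec[of "g * Q / q" q k] qpoch_Suc[of "g * Q / q" q k] nz
    by (simp add: W_def V_def K_def)
  have Y: "(1 - Q) * Y = - Q * (U * (1 - K / Q))"
  proof -
    have "(1 - 1 / Q) * Y = U * (1 - K / Q)"
      using qpoch_rec[of "1 / Q" q k] qpoch_Suc[of "1 / Q" q k] nz nz'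
      by (simp add: Y_def U_def K_def)
    moreover have "1 - Q = - Q * (1 - 1 / Q)" using nz' by (simp add: field_simps)
    ultimately show ?thesis by (simp only: mult.assoc)
  qed
  have qk: "q ^ Suc k = K * q" by (simp add: K_def)
  have D1: "aw_coeff a b c d q (Q * q) (Suc k) - aw_coeff a b c d q Q (Suc k)
      = (- (1 - K * q) / (Q * q) * (1 - g * Q\<^sup>2) * (U * W)) * (K * q) / E'"
  proof -
    have "aw_coeff a b c d q (Q * q) (Suc k) - aw_coeff a b c d q Q (Suc k)
      = (qpoch (1 / (Q * q)) q (Suc k) * qpoch (g * Q) q (Suc k)
        - qpoch (1 / Q) q (Suc k) * qpoch (g * Q / q) q (Suc k)) * (K * q) / E'"
    proof -
      have "a * b * c * d * (Q * q) / q = g * Q" using nz by (simp add: g_def)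
      then show ?thesis
        unfolding aw_coeff_def E'_eq qk by (simp add: g_def diff_divide_distrib left_diff_distrib)
    qed
    then show ?thesis
      unfolding qpoch_shift_diff[OF nz(2) nz'(1)] qk U_def W_def .
  qed
  have D2: "aw_coeff a b c d q (Q / q) (Suc k) - aw_coeff a b c d q Q (Suc k)
      = ((1 - K * q) / Q * (1 - g * Q\<^sup>2 / q\<^sup>2) * (Y * V)) * (K * q) / E'"
  proof -
    have Qq: "Q / q \<noteq> 0" using nz nz' by simp
    have "aw_coeff a b c d q (Q / q) (Suc k) - aw_coeff a b c d q Q (Suc k)
      = - (qpoch (1 / (Q / q * q)) q (Suc k) * qpoch (g * (Q / q)) q (Suc k)
        - qpoch (1 / (Q / q)) q (Suc k) * qpoch (g * (Q / q) / q) q (Suc k)) * (K * q) / E'"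
      using nz unfolding aw_coeff_def E'_eq qk g_def by (simp add: diff_divide_distrib left_diff_distrib)
    also have "\<dots> = ((1 - K * q) / Q * (1 - g * Q\<^sup>2 / q\<^sup>2) * (Y * V)) * (K * q) / E'"
    proof -
      define w where "w = 1 - K * q"
      show ?thesis
        unfolding qpoch_shift_diff[OF nz(2) Qq] qk Y_def V_def w_def[symmetric]
        using nz by (simp add: power_divide)
    qed
    finally show ?thesis .
  qed
  define N1 where "N1 = (1 - a * b * Q) * (1 - a * c * Q) * (1 - a * d * Q)"
  define N2 where "N2 = (1 - b * c * Q / q) * (1 - b * d * Q / q) * (1 - c * d * Q / q)"
  define G where "G = 1 - g * Q\<^sup>2 / q"
  have G: "G \<noteq> 0" using g by (simp add: G_def)
  have eta: "aw_eta a b c d q n = N1 * (1 - g * Q / q) / (a * (1 - g * Q\<^sup>2) * G)"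
    using nz by (simp add: aw_eta_eq N1_def G_def Q_def g_def)
  have xi: "aw_xi a b c d q n = a * (1 - Q) * N2 / ((1 - g * Q\<^sup>2 / q\<^sup>2) * G)"
    using nz by (simp add: aw_xi_eq N2_def G_def Q_def g_def mult.assoc)
  have T1: "aw_eta a b c d q n * (aw_coeff a b c d q (Q * q) (Suc k) - aw_coeff a b c d q Q (Suc k))
     = S * (N1 * (1 - g * Q * K / q) / (a * Q * q)) / G"
  proof -
    have "aw_eta a b c d q n * (aw_coeff a b c d q (Q * q) (Suc k) - aw_coeff a b c d q Q (Suc k))
       = N1 * ((1 - g * Q / q) * W) / (a * G) * (- (1 - K * q) / (Q * q) * U) * (K * q) / E'"
      unfolding eta D1 using g(1) by (simp add: mult_ac)
    also have "\<dots> = S * (N1 * (1 - g * Q * K / q) / (a * Q * q)) / G"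
      unfolding W S_def by (simp add: mult_ac)
    finally show ?thesis .
  qed
  have T2: "aw_xi a b c d q n * (aw_coeff a b c d q (Q / q) (Suc k) - aw_coeff a b c d q Q (Suc k))
     = S * (a * N2 * (1 - K / Q)) / G"
  proof -
    have "aw_xi a b c d q n * (aw_coeff a b c d q (Q / q) (Suc k) - aw_coeff a b c d q Q (Suc k))
       = a * ((1 - Q) * Y) * N2 / G * ((1 - K * q) / Q * V) * (K * q) / E'"
    proof -
      define w where "w = 1 - g * Q\<^sup>2 / q\<^sup>2"
      have "w \<noteq> 0" using g(3) by (simp add: w_def)
      then show ?thesis
        unfolding xi D2 w_def[symmetric] by (simp add: mult_ac)
    qed
    also have "\<dots> = S * (a * N2 * (1 - K / Q)) / G"
    proof -
      define w where "w = 1 - K * q"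
      show ?thesis
        unfolding Y S_def w_def[symmetric] using nz' by (simp add: mult_ac)
    qed
    finally show ?thesis .
  qed
  have C1: "aw_coeff a b c d q Q (Suc k) = U * V * ((1 - K / Q) * (1 - g * Q * K / q)) * (K * q) / E'"
    unfolding aw_coeff_def E'_eq qk by (simp add: qpoch_Suc U_def V_def K_def g_def mult_ac)
  have C0: "aw_coeff a b c d q Q k = U * V * K / E"
    by (simp add: aw_coeff_def U_def V_def K_def g_def E_def)
  have R1: "(a * K * q + 1 / (a * K * q) - a - 1 / a) * aw_coeff a b c d q Q (Suc k)
     = S * ((a - 1 / (a * K * q)) * (1 - K / Q) * (1 - g * Q * K / q))"
  proof -
    have "a * K * q + 1 / (a * K * q) - a - 1 / a = - (1 - K * q) * (a - 1 / (a * K * q))"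
      using nz nz' by (simp add: field_simps)
    then show ?thesis unfolding C1 S_def by (simp only: times_divide_eq_left times_divide_eq_right mult_ac)
  qed
  have R2: "aw_coeff a b c d q Q k / (a * K) = - (S * (F / (a * K * q)))"
  proof -
    have "- (S * (F / (a * K * q))) = U * V * K * ((1 - K * q) * F) / (E * ((1 - K * q) * F)) / (a * K)"
    proof -
      define w where "w = 1 - K * q"
      show ?thesis
        unfolding S_def E'_def w_def[symmetric] using nz nz' by (simp add: mult_ac)
    qed
    also have "\<dots> = U * V * K / E / (a * K)"
      using F by (subst nonzero_mult_divide_mult_cancel_right) simp_all
    finally show ?thesis by (simp add: C0)
  qed
  have core: "N1 * (1 - g * Q * K / q) / (a * Q * q) + a * N2 * (1 - K / Q)
     = G * ((a - 1 / (a * K * q)) * (1 - K / Q) * (1 - g * Q * K / q) + F / (a * K * q))"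
    using aw_core_identity[OF nz nz', of b c d]
    unfolding N1_def N2_def G_def F_def g_def by (simp only: mult.assoc)
  have "S * (N1 * (1 - g * Q * K / q) / (a * Q * q)) / G + S * (a * N2 * (1 - K / Q)) / G
     = S * (N1 * (1 - g * Q * K / q) / (a * Q * q) + a * N2 * (1 - K / Q)) / G"
    by (simp only: distrib_left add_divide_distrib)
  also have "\<dots> = S * ((a - 1 / (a * K * q)) * (1 - K / Q) * (1 - g * Q * K / q)) + S * (F / (a * K * q))"
  proof -
    have "S * (G * x) / G = S * x" for x using G by simp
    then show ?thesis unfolding core distrib_left[of S, symmetric] .
  qed
  finally show ?thesis
    unfolding T1 T2 R1 R2 by simp
qed

text \<open>The three-term recurrence for truncated \<open>\<^sub>4\<phi>\<^sub>3\<close> sums. The boundary term is the one that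
  multiplication by \<open>z + 1/z\<close> pushes out of the truncation range; at a root of unity it is exactly
  what makes the polynomial of degree \<open>N\<close> explicit, although its own \<open>\<^sub>4\<phi>\<^sub>3\<close> would involve the
  vanishing factor \<open>(q;q)\<^sub>N\<close>.\<close>

lemma aw_sum_recurrence:
  fixes a b c d q z :: complex and n m :: nat
  defines "Q \<equiv> q ^ n" and "g \<equiv> a * b * c * d"
  defines "C \<equiv> aw_coeff a b c d q"
  assumes nz: "a \<noteq> 0" "q \<noteq> 0" "z \<noteq> 0"
    and g: "1 - g * Q\<^sup>2 \<noteq> 0" "1 - g * Q\<^sup>2 / q \<noteq> 0" "1 - g * Q\<^sup>2 / q\<^sup>2 \<noteq> 0"
    and fac: "\<And>k. k < m \<Longrightarrow> 1 - a * b * q ^ k \<noteq> 0 \<and> 1 - a * c * q ^ k \<noteq> 0 \<and> 1 - a * d * q ^ k \<noteq> 0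
       \<and> 1 - q ^ k * q \<noteq> 0"
  shows "(z + inverse z - aw_v a b c d q n) * (\<Sum>k<Suc m. C Q k * aw_basis a q z k)
      - aw_xi a b c d q n * (\<Sum>k<Suc m. C (Q / q) k * aw_basis a q z k)
    = aw_eta a b c d q n * (\<Sum>k<Suc m. C (Q * q) k * aw_basis a q z k)
      - C Q m / (a * q ^ m) * aw_basis a q z (Suc m)"
  using fac
proof (induction m)
  case 0
  have "aw_basis a q z (Suc 0) = 1 + a\<^sup>2 - a * (z + inverse z)"
    using aw_basis_Suc[OF nz(3), of a q 0] by simp
  then have "aw_basis a q z (Suc 0) / a = 1 / a + a - (z + inverse z)"
    using nz by (simp add: field_simps power2_eq_square)
  then show ?case
    by (simp add: C_def aw_v_def inverse_eq_divide)
next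
  case (Suc m)
  define K where "K = q ^ m"
  have K: "K \<noteq> 0" using nz by (simp add: K_def)
  define x where "x = z + inverse z"
  define p where "p = aw_basis a q z (Suc m)"
  have pS: "aw_basis a q z (Suc (Suc m)) = (1 + (a * K * q)\<^sup>2 - a * K * q * x) * p"
    unfolding p_def x_def K_def by (subst aw_basis_Suc[OF nz(3)]) (simp add: mult_ac)
  have rec: "aw_eta a b c d q n * (C (Q * q) (Suc m) - C Q (Suc m))
      + aw_xi a b c d q n * (C (Q / q) (Suc m) - C Q (Suc m))
    = (a * K * q + 1 / (a * K * q) - a - 1 / a) * C Q (Suc m) - C Q m / (a * K)"
    unfolding C_def K_def Q_def
    by (rule aw_coeff_recurrence) (use nz g Suc.prems[of m] in \<open>auto simp: g_def Q_def\<close>)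
  have v: "x - aw_v a b c d q n = x - a - 1 / a + aw_xi a b c d q n + aw_eta a b c d q n"
    by (simp add: aw_v_def inverse_eq_divide)
  have tail: "C Q (Suc m) / (a * q ^ Suc m) * aw_basis a q z (Suc (Suc m))
     = (a * K * q + 1 / (a * K * q) - x) * C Q (Suc m) * p"
    unfolding pS using nz K by (simp add: K_def field_simps power2_eq_square)
  have step: "(x - aw_v a b c d q n) * C Q (Suc m) - aw_xi a b c d q n * C (Q / q) (Suc m)
     = aw_eta a b c d q n * C (Q * q) (Suc m) + C Q m / (a * K)
       - (a * K * q + 1 / (a * K * q) - x) * C Q (Suc m)"
    using rec unfolding v by algebra
  have IH: "(x - aw_v a b c d q n) * (\<Sum>k<Suc m. C Q k * aw_basis a q z k)
      - aw_xi a b c d q n * (\<Sum>k<Suc m. C (Q / q) k * aw_basis a q z k)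
    = aw_eta a b c d q n * (\<Sum>k<Suc m. C (Q * q) k * aw_basis a q z k)
      - C Q m / (a * K) * p"
    using Suc by (simp add: x_def p_def K_def del: sum.lessThan_Suc)
  have split: "(\<Sum>k<Suc (Suc m). C y k * aw_basis a q z k)
      = (\<Sum>k<Suc m. C y k * aw_basis a q z k) + C y (Suc m) * p" for y
    by (simp add: p_def)
  show ?case
    unfolding split tail x_def[symmetric] using IH arg_cong[OF step, of "\<lambda>w. w * p"]
    by (simp only: ring_distribs diff_conv_add_uminus) (simp add: algebra_simps)
qed

section \<open>The polynomial of degree \<open>N\<close> and its zeros\<close>

text \<open>The hypotheses of the theorem, with "not an integer power of \<open>q\<close>" rephrased as
  "\<open>N\<close>-th power different from 1" and \<open>E\<^sub>N \<noteq> \<plusminus>2\<close> as \<open>r\<^sup>2\<^sup>N \<noteq> 1\<close>.\<close>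

locale aw_root_of_unity = primitive_root +
  fixes a b c d r :: complex
  assumes nz [simp]: "a \<noteq> 0" "b \<noteq> 0" "c \<noteq> 0" "d \<noteq> 0" "r \<noteq> 0"
    and pair: "(a * b) ^ N \<noteq> 1" "(a * c) ^ N \<noteq> 1" "(a * d) ^ N \<noteq> 1"
      "(b * c) ^ N \<noteq> 1" "(b * d) ^ N \<noteq> 1" "(c * d) ^ N \<noteq> 1"
    and quad: "(a * b * c * d) ^ N \<noteq> 1"
    and r2: "(r ^ N)\<^sup>2 \<noteq> 1"
    and rE: "r ^ N + inverse (r ^ N) = aw_E a b c d N"
begin

abbreviation "g \<equiv> a * b * c * d"
abbreviation "xi \<equiv> aw_xi a b c d q"
abbreviation "eta \<equiv> aw_eta a b c d q"
abbreviation "X \<equiv> continuant (aw_v a b c d q) (aw_u a b c d q)"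
abbreviation "C \<equiv> aw_coeff a b c d q"
abbreviation "basis \<equiv> aw_basis a q"

lemma q_quotient_N: "(q ^ i / q ^ j) ^ N = 1"
  by (simp add: power_divide q_pow_N)

lemma g_q_nonzero:
  "1 - g * (q ^ n)\<^sup>2 \<noteq> 0" "1 - g * (q ^ n)\<^sup>2 / q \<noteq> 0" "1 - g * (q ^ n)\<^sup>2 / q\<^sup>2 \<noteq> 0"
  using one_minus_nonzero[OF quad q_quotient_N, of "2 * n" 0]
    one_minus_nonzero[OF quad q_quotient_N, of "2 * n" 1]
    one_minus_nonzero[OF quad q_quotient_N, of "2 * n" 2]
  by (simp_all add: power_even_eq)

lemma denominators_nonzero:
  assumes "k < N - 1"
  shows "1 - a * b * q ^ k \<noteq> 0 \<and> 1 - a * c * q ^ k \<noteq> 0 \<and> 1 - a * d * q ^ k \<noteq> 0 \<and> 1 - q ^ k * q \<noteq> 0"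
  using one_minus_nonzero[OF pair(1) q_pow_N] one_minus_nonzero[OF pair(2) q_pow_N]
    one_minus_nonzero[OF pair(3) q_pow_N] q_prim[of "Suc k"] assms
  by (simp add: mult.commute)

lemma recurrence_at:
  assumes "z \<noteq> 0"
  shows "(z + inverse z - aw_v a b c d q n) * (\<Sum>k<N. C (q ^ n) k * basis z k)
      - xi n * (\<Sum>k<N. C (q ^ n / q) k * basis z k)
    = eta n * (\<Sum>k<N. C (q ^ n * q) k * basis z k)
      - C (q ^ n) (N - 1) / (a * q ^ (N - 1)) * basis z N"
proof -
  have "Suc (N - 1) = N" using N_pos by simp
  have "(z + inverse z - aw_v a b c d q n) * (\<Sum>k<Suc (N - 1). C (q ^ n) k * basis z k)
      - xi n * (\<Sum>k<Suc (N - 1). C (q ^ n / q) k * basis z k)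
    = eta n * (\<Sum>k<Suc (N - 1). C (q ^ n * q) k * basis z k)
      - C (q ^ n) (N - 1) / (a * q ^ (N - 1)) * basis z (Suc (N - 1))"
    by (rule aw_sum_recurrence[OF nz(1) q_nonzero assms g_q_nonzero denominators_nonzero])
  then show ?thesis unfolding \<open>Suc (N - 1) = N\<close> .
qed

lemma X_Suc_from_pred:
  assumes "z \<noteq> 0"
    and "X (z + inverse z) n 0 = (\<Prod>j<n. eta j) * (\<Sum>k<N. C (q ^ n) k * basis z k)"
    and "\<And>m. n = Suc m \<Longrightarrow>
      X (z + inverse z) m 0 = (\<Prod>j<m. eta j) * (\<Sum>k<N. C (q ^ m) k * basis z k)"
  shows "X (z + inverse z) (Suc n) 0 = (\<Prod>j<n. eta j) *
     (eta n * (\<Sum>k<N. C (q ^ n * q) k * basis z k)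
      - C (q ^ n) (N - 1) / (a * q ^ (N - 1)) * basis z N)"
proof (cases n)
  case 0
  have "xi 0 = 0" by (simp add: aw_xi_eq)
  moreover have "(\<Sum>k<N. C (q ^ 0) k * basis z k) = 1"
    using assms(2) 0 by simp
  ultimately show ?thesis
    using recurrence_at[OF assms(1), of n] by (simp add: 0)
next
  case (Suc m)
  have "q ^ n / q = q ^ m" using Suc by simp
  have "X (z + inverse z) (Suc n) 0 = (z + inverse z - aw_v a b c d q n) * X (z + inverse z) n 0
      - aw_u a b c d q n * X (z + inverse z) m 0"
    unfolding Suc continuant_back by simp
  also have "aw_u a b c d q n = xi n * eta m" by (simp add: aw_u_def Suc)
  finally show ?thesis
    unfolding assms(2) assms(3)[OF Suc] recurrence_at[OF assms(1), of n, symmetric] \<open>q ^ n / q = q ^ m\<close>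
    by (simp add: Suc algebra_simps)
qed

lemma coeff_at_1: "C 1 k = (if k = 0 then 1 else 0)"
proof (cases k)
  case (Suc m)
  have "qpoch (1 / 1) q k = 0" unfolding qpoch_eq_0_iff Suc by (intro exI[of _ 0]) simp
  then show ?thesis using Suc by (simp add: aw_coeff_def)
qed simp

lemma X_hypergeometric:
  assumes "z \<noteq> 0" "n < N"
  shows "X (z + inverse z) n 0 = (\<Prod>j<n. eta j) * (\<Sum>k<N. C (q ^ n) k * basis z k)"
  using assms(2)
proof (induction n rule: less_induct)
  case (less n)
  show ?case
  proof (cases n)
    case 0
    have "(\<Sum>k<N. C 1 k * basis z k) = (\<Sum>k<N. if k = 0 then 1 else 0)"
      by (rule sum.cong) (auto simp: coeff_at_1)
    then show ?thesis using N_pos 0 by simp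
  next
    case (Suc m)
    have "qpoch (1 / q ^ m) q (N - 1) = 0"
      unfolding qpoch_eq_0_iff using less.prems Suc by (intro exI[of _ m]) simp
    then have "C (q ^ m) (N - 1) = 0" by (simp add: aw_coeff_def)
    moreover have "X (z + inverse z) (Suc m) 0 = (\<Prod>j<m. eta j) *
     (eta m * (\<Sum>k<N. C (q ^ m * q) k * basis z k)
      - C (q ^ m) (N - 1) / (a * q ^ (N - 1)) * basis z N)"
      by (rule X_Suc_from_pred[OF assms(1)]) (use less Suc in auto)
    ultimately show ?thesis by (simp add: Suc mult.commute[of q] del: continuant.simps)
  qed
qed

text \<open>For \<open>A = a\<^sup>N, \<dots>\<close> this computes \<open>E\<^sub>N - a\<^sup>N - a\<^sup>-\<^sup>N\<close> as a product. It identifies the constant term of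
  the polynomial of degree \<open>N\<close> and, the factors being nonzero, shows that \<open>r\<^sup>N\<close> is none of \<open>a\<^sup>N, a\<^sup>-\<^sup>N, \<dots>\<close>.\<close>

lemma aw_E_minus:
  assumes "A \<noteq> 0" "A * B * D * F \<noteq> (1::complex)"
  shows "(A + B + D + F - A * B * D - B * D * F - A * B * F - A * D * F) / (1 - A * B * D * F)
     = A + inverse A - (1 - A * B) * (1 - A * D) * (1 - A * F) / (A * (1 - A * B * D * F))"
proof -
  define G where "G = 1 - A * B * D * F"
  have G: "G \<noteq> 0" using assms(2) by (simp add: G_def)
  define T where "T = A + B + D + F - A * B * D - B * D * F - A * B * F - A * D * F"
  define W where "W = (1 - A * B) * (1 - A * D) * (1 - A * F)"
  have W: "W = (A * A + 1) * G - A * T"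
    unfolding G_def T_def W_def by (simp add: algebra_simps)
  show ?thesis
    unfolding G_def[symmetric] T_def[symmetric] W_def[symmetric] W
    using G assms(1) by (simp add: field_simps)
qed

text \<open>In the recurrence step from \<open>N - 1\<close> to \<open>N\<close> the coefficients with index \<open>0 < k < N\<close> vanish, because
  \<open>(q\<^sup>-\<^sup>N;q)\<^sub>k = (1;q)\<^sub>k = 0\<close>. Only the constant and the boundary term survive, and the latter is
  \<open>(az;q)\<^sub>N (a/z;q)\<^sub>N = (1 - a\<^sup>N z\<^sup>N) (1 - a\<^sup>N z\<^sup>-\<^sup>N)\<close>.\<close>

lemma X_N:
  assumes z: "z \<noteq> 0"
  shows "X (z + inverse z) N 0 = z ^ N + inverse (z ^ N) - aw_E a b c d N"
proof -
  define M where "M = N - 1"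
  have N: "N = Suc M" using N_pos by (simp add: M_def)
  define G where "G = 1 - g ^ N"
  have G: "G \<noteq> 0" using quad by (simp add: G_def)
  have qM: "q ^ M = 1 / q" using q_pow_pred by (simp add: M_def)
  have gq: "(g / q) ^ N \<noteq> 1" using quad q_N by (simp add: power_divide)
  have gq2: "(g / q / q) ^ N \<noteq> 1" using quad q_N by (simp only: power_divide) simp
  have one: "(\<Sum>k<N. C (q ^ M * q) k * basis z k) = 1"
  proof -
    have "q ^ M * q = 1" by (simp add: qM)
    then have "(\<Sum>k<N. C (q ^ M * q) k * basis z k) = (\<Sum>k<N. if k = 0 then 1 else 0)"
      by (intro sum.cong) (auto simp: coeff_at_1)
    then show ?thesis using N_pos by simp
  qed
  have "X (z + inverse z) N 0 = (\<Prod>j<M. eta j) *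
     (eta M * (\<Sum>k<N. C (q ^ M * q) k * basis z k)
      - C (q ^ M) (N - 1) / (a * q ^ (N - 1)) * basis z N)"
    unfolding N by (rule X_Suc_from_pred[OF z, unfolded N])
      (use X_hypergeometric[OF z, unfolded N] in auto)
  also have "\<dots> = (\<Prod>j<N. eta j) - (\<Prod>j<M. eta j) * (C (q ^ M) M / (a * q ^ M)) * basis z N"
    unfolding one by (simp add: N algebra_simps)
  also have "(\<Prod>j<N. eta j) = (1 - a^N * b^N) * (1 - a^N * c^N) * (1 - a^N * d^N) / (a^N * G)"
  proof -
    have "qpoch (g / q) q (2 * N) = qpoch (g / q) q N * qpoch (g / q) q N"
      by (simp add: mult_2 qpoch_add q_N)
    moreover have "qpoch (g / q) q N = G"
      by (simp add: qpoch_N G_def power_divide q_N)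
    ultimately show ?thesis
      using G unfolding prod_aw_eta[OF q_nonzero] qpoch_N by (simp add: power_mult_distrib)
  qed
  also have "(\<Prod>j<M. eta j) * (C (q ^ M) M / (a * q ^ M)) = 1 / a ^ N"
  proof -
    have "qpoch (g / q) q (2 * M) = qpoch (g / q) q M * qpoch (g / q / q) q M"
      by (simp add: mult_2 qpoch_add qM)
    moreover have "qpoch q q M \<noteq> 0" using qpoch_q_nonzero[of M] N by simp
    moreover have "C (q ^ M) M = qpoch q q M * qpoch (g / q / q) q M * q ^ M
        / (qpoch (a * b) q M * qpoch (a * c) q M * qpoch (a * d) q M * qpoch q q M)"
      by (simp add: aw_coeff_def qM)
    ultimately show ?thesis
      using qpoch_nonzero[OF gq, of M] qpoch_nonzero[OF gq2, of M] qpoch_nonzero[OF pair(1), of M]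
        qpoch_nonzero[OF pair(2), of M] qpoch_nonzero[OF pair(3), of M]
      unfolding prod_aw_eta[OF q_nonzero] by (simp add: N)
  qed
  also have "basis z N = (1 - a ^ N * z ^ N) * (1 - a ^ N / z ^ N)"
    by (simp add: aw_basis_def qpoch_N power_mult_distrib power_divide)
  also have "aw_E a b c d N = a ^ N + inverse (a ^ N)
     - (1 - a^N * b^N) * (1 - a^N * c^N) * (1 - a^N * d^N) / (a^N * G)"
    using aw_E_minus[of "a ^ N" "b ^ N" "c ^ N" "d ^ N"] quad
    by (simp add: aw_E_def G_def power_mult_distrib)
  moreover have "1 / a ^ N * ((1 - a ^ N * z ^ N) * (1 - a ^ N / z ^ N))
     = inverse (a ^ N) + a ^ N - z ^ N - inverse (z ^ N)"
    using z by (simp add: field_simps)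
  ultimately show ?thesis by simp
qed

text \<open>The zeros of the polynomial of degree \<open>N\<close>: replacing \<open>r\<close> by \<open>r q\<^sup>s\<close> does not change \<open>r\<^sup>N\<close>.\<close>

abbreviation node :: "nat \<Rightarrow> complex" where
  "node s \<equiv> r * q ^ s + inverse (r * q ^ s)"

lemma node_pow_N: "(r * q ^ s) ^ N = r ^ N"
  by (simp add: power_mult_distrib q_pow_N)

lemma X_N_node: "X (node s) N 0 = 0"
  using X_N[of "r * q ^ s"] by (simp only: node_pow_N rE) simp

lemma node_square: "(r * q ^ s) * (r * q ^ t) \<noteq> 1"
proof
  assume *: "(r * q ^ s) * (r * q ^ t) = 1"
  have "(r ^ N)\<^sup>2 = ((r * q ^ s) * (r * q ^ t)) ^ N"
    by (simp only: power_mult_distrib[of "r * q ^ s"] node_pow_N power2_eq_square)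
  with * r2 show False by simp
qed

lemma inj_node: "inj_on node {..<N}"
proof (rule inj_onI)
  fix i j assume ij: "i \<in> {..<N}" "j \<in> {..<N}" and eq: "node i = node j"
  define y w where "y = r * q ^ i" and "w = r * q ^ j"
  have nz: "y \<noteq> 0" "w \<noteq> 0" by (simp_all add: y_def w_def)
  have "(y - w) * (y * w - 1) = 0"
    using eq nz unfolding y_def[symmetric] w_def[symmetric] by (simp add: field_simps)
  moreover have "y * w \<noteq> 1" unfolding y_def w_def by (rule node_square)
  ultimately have "q ^ i = q ^ j" by (simp add: y_def w_def)
  then show "i = j" using inj_q_pow ij by (auto dest: inj_onD)
qed

text \<open>Obtained by differentiating \<open>P\<^sub>N(z + 1/z) = z\<^sup>N + z\<^sup>-\<^sup>N - E\<^sub>N\<close> with respect to \<open>z\<close>.\<close>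

lemma X_N_deriv_node:
  "poly (pderiv (continuant_poly (aw_v a b c d q) (aw_u a b c d q) N 0)) (node s)
    * (r * q ^ s - inverse (r * q ^ s)) = of_nat N * (r ^ N - inverse (r ^ N))"
proof -
  define y where "y = r * q ^ s"
  have y: "y \<noteq> 0" by (simp add: y_def)
  define P where "P = continuant_poly (aw_v a b c d q) (aw_u a b c d q) N 0"
  have P: "poly P (z + inverse z) = z ^ N + inverse (z ^ N) - aw_E a b c d N" if "z \<noteq> 0" for z
    using X_N[OF that] by (simp add: P_def poly_continuant_poly)
  let ?D = "of_nat N * (y ^ N - inverse (y ^ N)) / y"
  have "((\<lambda>z. poly P (z + inverse z)) has_field_derivative
     poly (pderiv P) (y + inverse y) * (1 - inverse (y ^ 2))) (at y)"
  proof (rule DERIV_chain2[OF poly_DERIV])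
    show "((\<lambda>z. z + inverse z) has_field_derivative 1 - inverse (y ^ 2)) (at y)"
      using y by (auto intro!: derivative_eq_intros simp: power2_eq_square)
  qed
  moreover have "((\<lambda>z. z ^ N + inverse (z ^ N) - aw_E a b c d N) has_field_derivative ?D) (at y)"
  proof -
    define p where "p = y ^ (N - 1)"
    have p: "y ^ N = y * p" "p \<noteq> 0"
      using N_pos y power_minus_mult[of N y] by (simp_all add: p_def mult.commute)
    have "((\<lambda>z. z ^ N + inverse (z ^ N) - aw_E a b c d N) has_field_derivative
      of_nat N * p - inverse (y ^ N) * (of_nat N * p) * inverse (y ^ N)) (at y)"
      using y by (auto intro!: derivative_eq_intros simp: p_def)
    moreover have "of_nat N * p - inverse (y ^ N) * (of_nat N * p) * inverse (y ^ N) = ?D"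
      unfolding p(1) using y p(2) by (simp add: field_simps)
    ultimately show ?thesis by simp
  qed
  then have "((\<lambda>z. poly P (z + inverse z)) has_field_derivative ?D) (at y)"
    by (rule has_field_derivative_transform_within_open[of _ _ _ "- {0}"])
       (use y P in auto)
  ultimately have "poly (pderiv P) (y + inverse y) * (1 - inverse (y ^ 2)) = ?D"
    by (rule DERIV_unique)
  moreover have "1 - inverse (y ^ 2) = (y - inverse y) / y"
    using y by (simp add: field_simps power2_eq_square)
  moreover have "y ^ N = r ^ N" by (simp add: y_def node_pow_N)
  ultimately show ?thesis
    using y by (simp add: y_def[symmetric] P_def[symmetric])
qed

end

section \<open>The Askey-Wilson difference operator\<close>

text \<open>The coefficient function \<open>A(z)\<close> of the Askey-Wilson divided difference operator
  \<open>(D f)(z) = A(z) (f(qz) - f(z)) + A(1/z) (f(z/q) - f(z))\<close>.\<close>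

definition aw_shift_factor :: "complex \<Rightarrow> complex \<Rightarrow> complex \<Rightarrow> complex \<Rightarrow> complex \<Rightarrow> complex \<Rightarrow> complex" where
  "aw_shift_factor a b c d q z = (1 - a * z) * (1 - b * z) * (1 - c * z) * (1 - d * z)
     / ((1 - z\<^sup>2) * (1 - q * z\<^sup>2))"

text \<open>Eigenvalue of \<open>D\<close> on the Askey-Wilson polynomial of degree \<open>k\<close>.\<close>

definition aw_eigen :: "complex \<Rightarrow> complex \<Rightarrow> nat \<Rightarrow> complex" where
  "aw_eigen g q k = (1 / q ^ k - 1) * (1 - g * q ^ k / q)"

text \<open>One of the two summands of \<open>D\<close> on a basis element; the other one follows from the symmetry
  \<open>z \<mapsto> 1/z\<close> of the basis.\<close>

lemma aw_half_difference:
  assumes nz: "q \<noteq> 0" "z \<noteq> 0" and z: "q * z\<^sup>2 \<noteq> 1"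
  shows "aw_shift_factor a b c d q z * (aw_basis a q (q * z) (Suc m) - aw_basis a q z (Suc m))
    = - (1 - q ^ m * q) * (a / (q * z)) * ((1 - b * z) * (1 - c * z) * (1 - d * z) * (1 - a * z * q ^ m))
      / (1 - z\<^sup>2) * aw_basis a q z m"
proof -
  define K where "K = q ^ m"
  define U where "U = qpoch (a * z * q) q m"
  define V where "V = qpoch (a / z) q m"
  define w where "w = 1 - q * z\<^sup>2"
  have w: "w \<noteq> 0" using z by (simp add: w_def)
  have U: "(1 - a * z) * U = qpoch (a * z) q m * (1 - a * z * K)"
    using qpoch_rec[of "a * z" q m] qpoch_Suc[of "a * z" q m] by (simp add: U_def K_def)
  have b1: "aw_basis a q (q * z) (Suc m) = U * (1 - a * z * q * K) * ((1 - a / (q * z)) * V)"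
  proof -
    have "qpoch (a * (q * z)) q (Suc m) = U * (1 - a * z * q * K)"
      by (simp add: qpoch_Suc U_def K_def mult_ac)
    moreover have "qpoch (a / (q * z)) q (Suc m) = (1 - a / (q * z)) * V"
      using nz by (simp add: qpoch_rec V_def)
    ultimately show ?thesis by (simp add: aw_basis_def)
  qed
  have b2: "aw_basis a q z (Suc m) = (1 - a * z) * U * (V * (1 - a / z * K))"
    unfolding aw_basis_def by (simp only: qpoch_rec[of "a * z"] qpoch_Suc[of "a / z"] U_def V_def K_def)
  have "(1 - a * z * q * K) * (1 - a / (q * z)) - (1 - a * z) * (1 - a / z * K)
     = - (1 - K * q) * (a / (q * z)) * w"
    using nz by (simp add: w_def field_simps power2_eq_square)
  then have "aw_basis a q (q * z) (Suc m) - aw_basis a q z (Suc m)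
     = - (1 - K * q) * (a / (q * z)) * w * (U * V)"
    unfolding b1 b2 by algebra
  moreover have "aw_shift_factor a b c d q z = (1 - a * z) * ((1 - b * z) * (1 - c * z) * (1 - d * z)) / ((1 - z\<^sup>2) * w)"
    by (simp add: aw_shift_factor_def w_def mult.assoc)
  ultimately have "aw_shift_factor a b c d q z * (aw_basis a q (q * z) (Suc m) - aw_basis a q z (Suc m))
     = - (1 - K * q) * (a / (q * z)) * ((1 - b * z) * (1 - c * z) * (1 - d * z)) / (1 - z\<^sup>2)
        * ((1 - a * z) * U) * V"
    using w by (simp add: mult_ac)
  then show ?thesis
    unfolding U by (simp add: aw_basis_def V_def K_def mult_ac)
qed

lemma aw_difference_core:
  fixes a b c d q K z :: complex
  assumes nz: "q \<noteq> 0" "z \<noteq> 0" "K \<noteq> 0" and z: "z\<^sup>2 \<noteq> 1"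
  shows "- (1 - K * q) * (a / (q * z)) * ((1 - b * z) * (1 - c * z) * (1 - d * z) * (1 - a * z * K))
        / (1 - z\<^sup>2)
     - (1 - K * q) * (a * z / q) * ((1 - b / z) * (1 - c / z) * (1 - d / z) * (1 - a / z * K))
        / (1 - (1 / z)\<^sup>2)
     = (1 / (K * q) - 1) * ((1 - a * b * c * d * K) * ((1 - a * z * K) * (1 - a / z * K))
         - (1 - a * b * K) * (1 - a * c * K) * (1 - a * d * K))"
proof -
  define y where "y = inverse z"
  define p where "p = inverse q"
  define l where "l = inverse K"
  define s where "s = inverse (1 - z\<^sup>2)"
  have z': "1 - z\<^sup>2 \<noteq> 0" using z by simp
  have r: "z * y = 1" "q * p = 1" "K * l = 1" "(1 - z\<^sup>2) * s = 1"
    using nz z' by (simp_all add: y_def p_def l_def s_def)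
  have "inverse (1 - y\<^sup>2) = - z\<^sup>2 * s"
  proof -
    have "(1 - y\<^sup>2) * (- z\<^sup>2 * s) = 1" using r by algebra
    then show ?thesis by (rule inverse_unique)
  qed
  moreover have "- (1 - K * q) * (a * p * y) * ((1 - b * z) * (1 - c * z) * (1 - d * z) * (1 - a * z * K)) * s
     - (1 - K * q) * (a * z * p) * ((1 - b * y) * (1 - c * y) * (1 - d * y) * (1 - a * y * K)) * (- z\<^sup>2 * s)
     = (l * p - 1) * ((1 - a * b * c * d * K) * ((1 - a * z * K) * (1 - a * y * K))
         - (1 - a * b * K) * (1 - a * c * K) * (1 - a * d * K))"
    using r by algebra
  ultimately show ?thesis
    by (simp add: y_def p_def l_def s_def divide_inverse mult_ac)
qed

text \<open>The operator \<open>D\<close> is bidiagonal in the Newton-type basis.\<close>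

lemma aw_difference_basis:
  assumes nz: "q \<noteq> 0" "z \<noteq> 0" and z: "z\<^sup>2 \<noteq> 1" "q * z\<^sup>2 \<noteq> 1" "z\<^sup>2 \<noteq> q"
  shows "aw_shift_factor a b c d q z * (aw_basis a q (q * z) (Suc m) - aw_basis a q z (Suc m))
    + aw_shift_factor a b c d q (1 / z) * (aw_basis a q (z / q) (Suc m) - aw_basis a q z (Suc m))
    = aw_eigen (a * b * c * d) q (Suc m) * aw_basis a q z (Suc m)
      - (1 / q ^ Suc m - 1) * ((1 - a * b * q ^ m) * (1 - a * c * q ^ m) * (1 - a * d * q ^ m))
        * aw_basis a q z m"
proof -
  define K where "K = q ^ m"
  have K: "K \<noteq> 0" using nz by (simp add: K_def)
  have flip: "aw_basis a q (1 / y) k = aw_basis a q y k" for y k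
    by (simp add: aw_basis_def)
  have f1: "aw_basis a q (q * (1 / z)) (Suc m) = aw_basis a q (z / q) (Suc m)"
    using flip[of "z / q"] by simp
  have z': "q * (1 / z)\<^sup>2 \<noteq> 1" using z nz by (simp add: power_divide field_simps)
  have z0: "1 / z \<noteq> 0" using nz by simp
  have e: "aw_eigen (a * b * c * d) q (Suc m) = (1 / (K * q) - 1) * (1 - a * b * c * d * K)"
    using nz by (simp add: aw_eigen_def K_def mult_ac)
  have bS: "aw_basis a q z (Suc m) = (1 - a * z * K) * (1 - a / z * K) * aw_basis a q z m"
    by (simp add: aw_basis_def qpoch_Suc K_def)
  define B where "B = aw_basis a q z m"
  have H: "aw_shift_factor a b c d q z * (aw_basis a q (q * z) (Suc m) - aw_basis a q z (Suc m))
     = - (1 - K * q) * (a / (q * z)) * ((1 - b * z) * (1 - c * z) * (1 - d * z) * (1 - a * z * K))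
        / (1 - z\<^sup>2) * B"
    unfolding aw_half_difference[OF nz z(2)] K_def B_def ..
  have H': "aw_shift_factor a b c d q (1 / z) * (aw_basis a q (z / q) (Suc m) - aw_basis a q z (Suc m))
     = - ((1 - K * q) * (a * z / q) * ((1 - b / z) * (1 - c / z) * (1 - d / z) * (1 - a / z * K))
        / (1 - (1 / z)\<^sup>2)) * B"
  proof -
    define h where "h = 1 - K * q"
    show ?thesis
      using aw_half_difference[OF nz(1) z0 z', of a b c d m]
      unfolding f1 flip K_def[symmetric] B_def[symmetric] h_def[symmetric]
      by simp
  qed
  have "(1 / (K * q) - 1) * (1 - a * b * c * d * K) * ((1 - a * z * K) * (1 - a / z * K) * B)
      - (1 / (K * q) - 1) * ((1 - a * b * K) * (1 - a * c * K) * (1 - a * d * K)) * B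
     = ((1 / (K * q) - 1) * ((1 - a * b * c * d * K) * ((1 - a * z * K) * (1 - a / z * K))
         - (1 - a * b * K) * (1 - a * c * K) * (1 - a * d * K))) * B"
    by (simp only: algebra_simps)
  then have R: "aw_eigen (a * b * c * d) q (Suc m) * aw_basis a q z (Suc m)
      - (1 / q ^ Suc m - 1) * ((1 - a * b * K) * (1 - a * c * K) * (1 - a * d * K)) * B
     = ((1 / (K * q) - 1) * ((1 - a * b * c * d * K) * ((1 - a * z * K) * (1 - a / z * K))
         - (1 - a * b * K) * (1 - a * c * K) * (1 - a * d * K))) * B"
    unfolding e bS power_Suc2 K_def[symmetric] B_def[symmetric] .
  have combine: "x * B + - y * B = (x - y) * B" for x y :: complex
    by (simp add: algebra_simps)
  show ?thesis
    unfolding K_def[symmetric] B_def[symmetric] R H H' aw_difference_core[OF nz K z(1), symmetric]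
    by (rule combine)
qed

lemma aw_shift_factor_inverse:
  assumes nz: "z \<noteq> 0"
  shows "aw_shift_factor a b c d q (1 / z) = (z - a) * (z - b) * (z - c) * (z - d) / ((z\<^sup>2 - 1) * (z\<^sup>2 - q))"
proof -
  have "aw_shift_factor a b c d q (1 / z) = ((1 - a * (1 / z)) * (1 - b * (1 / z)) * (1 - c * (1 / z)) * (1 - d * (1 / z)) * z ^ 4)
     / (((1 - (1 / z)\<^sup>2) * (1 - q * (1 / z)\<^sup>2)) * z ^ 4)"
    using nz by (simp add: aw_shift_factor_def)
  also have "(1 - a * (1 / z)) * (1 - b * (1 / z)) * (1 - c * (1 / z)) * (1 - d * (1 / z)) * z ^ 4
     = (z - a) * (z - b) * (z - c) * (z - d)"
    using nz by (simp add: power4_eq_xxxx field_simps)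
  also have "((1 - (1 / z)\<^sup>2) * (1 - q * (1 / z)\<^sup>2)) * z ^ 4 = (z\<^sup>2 - 1) * (z\<^sup>2 - q)"
    using nz by (simp add: power4_eq_xxxx power2_eq_square field_simps)
  finally show ?thesis .
qed

text \<open>The first and the third term are \<open>A(z) y(qz) / y(z)\<close> and \<open>A(1/z) y(z/q) / y(z)\<close> for the reciprocal \<open>y\<close>
  of the weights of the \<open>\<^sub>9\<phi>\<^sub>8\<close> series. So the identity says that \<open>y\<close> is an eigenfunction of \<open>D\<close>, with the
  eigenvalue that belongs to degree \<open>N - 1\<close> when \<open>q\<^sup>N = 1\<close>.\<close>

lemma aw_eigen_core:
  fixes a b c d q z :: complex
  assumes nz: "q \<noteq> 0" "z \<noteq> 0" and z: "z\<^sup>2 \<noteq> 1" "q * z\<^sup>2 \<noteq> 1" "z\<^sup>2 \<noteq> q"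
  shows "(a - q * z) * (b - q * z) * (c - q * z) * (d - q * z) / (q\<^sup>2 * ((1 - z\<^sup>2) * (1 - q * z\<^sup>2)))
      - aw_shift_factor a b c d q z
      + (q - a * z) * (q - b * z) * (q - c * z) * (q - d * z) / (q\<^sup>2 * ((z\<^sup>2 - 1) * (z\<^sup>2 - q)))
      - aw_shift_factor a b c d q (1 / z)
    = (q - 1) * (1 - a * b * c * d / q\<^sup>2)"
proof -
  define p where "p = inverse q"
  define s where "s = inverse (1 - z\<^sup>2)"
  define t where "t = inverse (1 - q * z\<^sup>2)"
  define u where "u = inverse (z\<^sup>2 - q)"
  have r: "q * p = 1" "(1 - z\<^sup>2) * s = 1" "(1 - q * z\<^sup>2) * t = 1" "(z\<^sup>2 - q) * u = 1"
    using nz z by (simp_all add: p_def s_def t_def u_def)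
  have "inverse (z\<^sup>2 - 1) = - s"
    unfolding s_def by (metis inverse_minus_eq minus_diff_eq)
  moreover have "(a - q * z) * (b - q * z) * (c - q * z) * (d - q * z) * (p\<^sup>2 * (s * t))
      - (1 - a * z) * (1 - b * z) * (1 - c * z) * (1 - d * z) * (s * t)
      + (q - a * z) * (q - b * z) * (q - c * z) * (q - d * z) * (p\<^sup>2 * (- s * u))
      - (z - a) * (z - b) * (z - c) * (z - d) * (- s * u)
    = (q - 1) * (1 - a * b * c * d * p\<^sup>2)"
    using r by algebra
  ultimately show ?thesis
    unfolding aw_shift_factor_inverse[OF nz(2)] unfolding aw_shift_factor_def divide_inverse inverse_mult_distrib power_inverse[symmetric]
      p_def[symmetric] s_def[symmetric] t_def[symmetric] u_def[symmetric]
    by simp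
qed

section \<open>The weights at the zeros\<close>

text \<open>The Newton-type basis as polynomials in \<open>z + 1/z\<close>.\<close>

definition pbasis :: "complex \<Rightarrow> complex \<Rightarrow> nat \<Rightarrow> complex poly" where
  "pbasis a q n = (\<Prod>j<n. [:1 + (a * q ^ j)\<^sup>2, - (a * q ^ j):])"

lemma poly_pbasis:
  assumes "z \<noteq> 0"
  shows "poly (pbasis a q n) (z + inverse z) = aw_basis a q z n"
  by (induction n) (simp_all add: pbasis_def aw_basis_Suc[OF assms] algebra_simps)

lemma degree_pbasis:
  assumes "a \<noteq> 0" "q \<noteq> 0"
  shows "degree (pbasis a q n) = n"
  unfolding pbasis_def using assms by (subst degree_prod_eq_sum_degree) auto

lemma pbasis_nonzero:
  assumes "a \<noteq> 0" "q \<noteq> 0"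
  shows "coeff (pbasis a q n) n \<noteq> 0"
proof -
  have "pbasis a q n \<noteq> 0" unfolding pbasis_def using assms by auto
  then show ?thesis using degree_pbasis[OF assms, of n] by (metis leading_coeff_0_iff)
qed

lemma pbasis_expansion:
  assumes nz: "a \<noteq> 0" "q \<noteq> 0" and deg: "\<And>i. i \<ge> n \<Longrightarrow> coeff p i = 0"
  shows "\<exists>e. p = (\<Sum>k<n. smult (e k) (pbasis a q k))"
  using deg
proof (induction n arbitrary: p)
  case 0
  then show ?case by (simp add: poly_eq_iff)
next
  case (Suc n)
  define l where "l = coeff p n / coeff (pbasis a q n) n"
  have "coeff (p - smult l (pbasis a q n)) i = 0" if "i \<ge> n" for i
  proof (cases "i = n")
    case True
    then show ?thesis using pbasis_nonzero[OF nz] by (simp add: l_def)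
  next
    case False
    with that have i: "i > n" by simp
    then have "coeff (pbasis a q n) i = 0" using degree_pbasis[OF nz] by (simp add: coeff_eq_0)
    then show ?thesis using i Suc.prems[of i] by simp
  qed
  from Suc.IH[OF this] obtain e where e: "p - smult l (pbasis a q n) = (\<Sum>k<n. smult (e k) (pbasis a q k))"
    by blast
  have "p = (\<Sum>k<Suc n. smult ((e(n := l)) k) (pbasis a q k))"
    using e by (simp add: algebra_simps)
  then show ?case by blast
qed

lemma pbasis_independent:
  assumes nz: "a \<noteq> 0" "q \<noteq> 0" and "(\<Sum>k<n. smult (e k) (pbasis a q k)) = 0" "k < n"
  shows "e k = 0"
  using assms(3,4)
proof (induction n)
  case (Suc n)
  have "coeff (\<Sum>k<Suc n. smult (e k) (pbasis a q k)) n = e n * coeff (pbasis a q n) n"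
  proof -
    have "(\<Sum>k<n. e k * coeff (pbasis a q k) n) = 0"
      by (rule sum.neutral) (auto simp: coeff_eq_0 degree_pbasis[OF nz])
    then show ?thesis by (simp add: coeff_sum)
  qed
  then have "e n * coeff (pbasis a q n) n = 0" unfolding Suc.prems(1) by simp
  then have "e n = 0" using pbasis_nonzero[OF nz, of n] by simp
  with Suc show ?case by (cases "k = n") auto
qed simp

context aw_root_of_unity
begin

text \<open>By the symmetry of \<open>E\<^sub>N\<close> in the four parameters, the product formula for \<open>E\<^sub>N - a\<^sup>N - a\<^sup>-\<^sup>N\<close> holds for each
  of them, and its factors are nonzero.\<close>

lemma root_ne:
  "r ^ N + inverse (r ^ N) \<noteq> a ^ N + inverse (a ^ N)"
  "r ^ N + inverse (r ^ N) \<noteq> b ^ N + inverse (b ^ N)"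
  "r ^ N + inverse (r ^ N) \<noteq> c ^ N + inverse (c ^ N)"
  "r ^ N + inverse (r ^ N) \<noteq> d ^ N + inverse (d ^ N)"
  using aw_E_minus[of "a ^ N" "b ^ N" "c ^ N" "d ^ N"] aw_E_minus[of "b ^ N" "a ^ N" "c ^ N" "d ^ N"]
    aw_E_minus[of "c ^ N" "a ^ N" "b ^ N" "d ^ N"] aw_E_minus[of "d ^ N" "a ^ N" "b ^ N" "c ^ N"]
    quad pair
  unfolding rE by (auto simp: aw_E_def power_mult_distrib mult_ac add_ac diff_diff_eq)

lemma param_root:
  "(a * r) ^ N \<noteq> 1" "(b * r) ^ N \<noteq> 1" "(c * r) ^ N \<noteq> 1" "(d * r) ^ N \<noteq> 1"
  "(q * r / a) ^ N \<noteq> 1" "(q * r / b) ^ N \<noteq> 1" "(q * r / c) ^ N \<noteq> 1" "(q * r / d) ^ N \<noteq> 1"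
proof -
  have 1: "(y * r) ^ N \<noteq> 1" if "y \<noteq> 0" "r ^ N + inverse (r ^ N) \<noteq> y ^ N + inverse (y ^ N)" for y
  proof
    assume "(y * r) ^ N = 1"
    then have "y ^ N * r ^ N = 1" by (simp add: power_mult_distrib)
    then have "r ^ N = inverse (y ^ N)" "inverse (r ^ N) = y ^ N"
      by (metis inverse_unique, metis inverse_unique mult.commute)
    then show False using that by simp
  qed
  have 2: "(q * r / y) ^ N \<noteq> 1" if "y \<noteq> 0" "r ^ N + inverse (r ^ N) \<noteq> y ^ N + inverse (y ^ N)" for y
  proof
    assume "(q * r / y) ^ N = 1"
    then have "r ^ N = y ^ N" using that q_N by (simp add: power_mult_distrib power_divide)
    then show False using that by simp
  qed
  show "(a * r) ^ N \<noteq> 1" "(b * r) ^ N \<noteq> 1" "(c * r) ^ N \<noteq> 1" "(d * r) ^ N \<noteq> 1"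
    using 1 root_ne by simp_all
  show "(q * r / a) ^ N \<noteq> 1" "(q * r / b) ^ N \<noteq> 1" "(q * r / c) ^ N \<noteq> 1" "(q * r / d) ^ N \<noteq> 1"
    using 2 root_ne by simp_all
qed

text \<open>The factors of the \<open>s\<close>-th term of the \<open>\<^sub>9\<phi>\<^sub>8\<close> series that contain the four parameters, and the power of
  its argument. The other factors only contribute the simple pole and \<open>r q\<^sup>s - 1/(r q\<^sup>s)\<close>.\<close>

definition rho :: "nat \<Rightarrow> complex" where
  "rho s = qpoch (a * r) q s * qpoch (b * r) q s * qpoch (c * r) q s * qpoch (d * r) q s
     / (qpoch (q * r / a) q s * qpoch (q * r / b) q s * qpoch (q * r / c) q s * qpoch (q * r / d) q s)
     * (q\<^sup>2 / g) ^ s"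

lemma rho_0 [simp]: "rho 0 = 1"
  by (simp add: rho_def)

lemma rho_nonzero: "rho s \<noteq> 0"
  using param_root by (simp add: rho_def qpoch_nonzero)

text \<open>This is the equation \<open>r\<^sup>N + r\<^sup>-\<^sup>N = E\<^sub>N\<close> multiplied by \<open>r\<^sup>N (1 - r\<^sup>2\<^sup>N)\<close>, up to the factor \<open>1 - g\<^sup>N\<close>.\<close>

lemma reflection:
  "(1 - a ^ N * r ^ N) * (1 - b ^ N * r ^ N) * (1 - c ^ N * r ^ N) * (1 - d ^ N * r ^ N)
   = (a ^ N - r ^ N) * (b ^ N - r ^ N) * (c ^ N - r ^ N) * (d ^ N - r ^ N)"
proof -
  define A B D F R where "A = a ^ N" and "B = b ^ N" and "D = c ^ N" and "F = d ^ N" and "R = r ^ N"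
  have R: "R \<noteq> 0" by (simp add: R_def)
  have G: "1 - A * B * D * F \<noteq> 0"
    using quad by (simp add: A_def B_def D_def F_def power_mult_distrib)
  have "R + inverse R = (A + B + D + F - A * B * D - B * D * F - A * B * F - A * D * F) / (1 - A * B * D * F)"
    using rE by (simp add: A_def B_def D_def F_def R_def aw_E_def power_mult_distrib)
  then have "(R + inverse R) * (1 - A * B * D * F) * R
      = (A + B + D + F - A * B * D - B * D * F - A * B * F - A * D * F) * R"
    using G by simp
  moreover have "(R + inverse R) * (1 - A * B * D * F) * R = (R * R + 1) * (1 - A * B * D * F)"
    using R by (simp add: field_simps)
  ultimately have "(R * R + 1) * (1 - A * B * D * F)
      = (A + B + D + F - A * B * D - B * D * F - A * B * F - A * D * F) * R" by simp
  then show ?thesis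
    unfolding A_def[symmetric] B_def[symmetric] D_def[symmetric] F_def[symmetric] R_def[symmetric]
    by algebra
qed

text \<open>Going once around the roots of unity must not change the weight; this is where the choice of
  \<open>r\<close> enters.\<close>

lemma rho_N: "rho N = 1"
proof -
  have "(1 - (q * r / a) ^ N) * (1 - (q * r / b) ^ N) * (1 - (q * r / c) ^ N) * (1 - (q * r / d) ^ N)
     = (a ^ N - r ^ N) * (b ^ N - r ^ N) * (c ^ N - r ^ N) * (d ^ N - r ^ N) / g ^ N"
    using q_N by (simp add: power_divide power_mult_distrib diff_divide_eq_iff)
  moreover have "(q\<^sup>2 / g) ^ N = 1 / g ^ N"
    by (simp add: power_divide q_pow_N)
  moreover have "(1 - (a * r) ^ N) * (1 - (b * r) ^ N) * (1 - (c * r) ^ N) * (1 - (d * r) ^ N)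
     = (a ^ N - r ^ N) * (b ^ N - r ^ N) * (c ^ N - r ^ N) * (d ^ N - r ^ N)"
    using reflection by (simp add: power_mult_distrib)
  moreover have "(1 - (a * r) ^ N) * (1 - (b * r) ^ N) * (1 - (c * r) ^ N) * (1 - (d * r) ^ N) \<noteq> 0"
    using param_root by simp
  ultimately show ?thesis
    unfolding rho_def qpoch_N by simp
qed

lemma rho_periodic: "rho (N + s) = rho s"
proof -
  have "rho (N + s) = rho N * rho s"
    by (simp add: rho_def qpoch_add q_N power_add mult_ac)
  then show ?thesis by (simp add: rho_N)
qed

lemma rho_Suc:
  fixes s
  defines "z \<equiv> r * q ^ s"
  shows "rho (Suc s) * ((a - q * z) * (b - q * z) * (c - q * z) * (d - q * z))
     = rho s * (q\<^sup>2 * ((1 - a * z) * (1 - b * z) * (1 - c * z) * (1 - d * z)))"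
proof -
  have f: "y - q * z = y * (1 - q * r / y * q ^ s)" if "y \<noteq> 0" for y
    using that by (simp add: z_def field_simps)
  define L where "L = (1 - q * r / a * q ^ s) * (1 - q * r / b * q ^ s) * (1 - q * r / c * q ^ s) * (1 - q * r / d * q ^ s)"
  define T where "T = (1 - a * z) * (1 - b * z) * (1 - c * z) * (1 - d * z)"
  have L: "L \<noteq> 0" 
    unfolding L_def
    using param_root(5-8)[THEN one_minus_nonzero[OF _ q_pow_N], of s]
    by (simp only: mult_eq_0_iff de_Morgan_disj simp_thms)
  have "rho (Suc s) = rho s * (T / L) * (q\<^sup>2 / g)"
    unfolding rho_def qpoch_Suc power_Suc L_def T_def z_def
    by (simp only: times_divide_times_eq times_divide_eq_left times_divide_eq_right
        divide_divide_eq_left mult_ac)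
  moreover have "(a - q * z) * (b - q * z) * (c - q * z) * (d - q * z) = g * L"
    unfolding L_def using f by (simp only: nz simp_thms mult_ac)
  ultimately show ?thesis
    unfolding T_def[symmetric] using L by simp
qed

abbreviation "pt s \<equiv> r * q ^ s"

lemma pt_generic: "(pt s)\<^sup>2 \<noteq> 1" "q * (pt s)\<^sup>2 \<noteq> 1" "(pt (Suc s))\<^sup>2 \<noteq> q"
proof -
  show "(pt s)\<^sup>2 \<noteq> 1" using node_square[of s s] by (simp add: power2_eq_square)
  show "q * (pt s)\<^sup>2 \<noteq> 1" using node_square[of "Suc s" s] by (simp add: power2_eq_square mult_ac)
  have "(pt (Suc s))\<^sup>2 = q * (pt (Suc s) * pt s)" by (simp add: power2_eq_square mult_ac)
  then show "(pt (Suc s))\<^sup>2 \<noteq> q" using node_square[of "Suc s" s] by (metis mult_cancel_left2 q_nonzero)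
qed

abbreviation "shift_factor \<equiv> aw_shift_factor a b c d q"

text \<open>The first-order recurrence of the weights expresses both neighbours of a value through that value,
  which reduces the difference equation to a rational identity in \<open>z\<close>.\<close>

lemma inverse_rho_eigen:
  fixes s
  defines "z \<equiv> pt (Suc s)"
  shows "shift_factor z * (inverse (rho (Suc (Suc s))) - inverse (rho (Suc s)))
      + shift_factor (1 / z) * (inverse (rho s) - inverse (rho (Suc s)))
    = (q - 1) * (1 - g / q\<^sup>2) * inverse (rho (Suc s))"
proof -
  have z0: "z \<noteq> 0" by (simp add: z_def)
  have zg: "z\<^sup>2 \<noteq> 1" "q * z\<^sup>2 \<noteq> 1" "z\<^sup>2 \<noteq> q"
    unfolding z_def using pt_generic(1,2)[of "Suc s"] pt_generic(3)[of s] by blast+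
  define f where "f k = inverse (rho k)" for k
  have fr: "f k * rho k = 1" for k using rho_nonzero[of k] by (simp add: f_def)
  define T where "T = (1 - a * z) * (1 - b * z) * (1 - c * z) * (1 - d * z)"
  define P where "P = (a - q * z) * (b - q * z) * (c - q * z) * (d - q * z)"
  define S where "S = (q - a * z) * (q - b * z) * (q - c * z) * (q - d * z)"
  define V where "V = (z - a) * (z - b) * (z - c) * (z - d)"
  define W1 where "W1 = (1 - z\<^sup>2) * (1 - q * z\<^sup>2)"
  define W2 where "W2 = (z\<^sup>2 - 1) * (z\<^sup>2 - q)"
  have up: "f (Suc (Suc s)) * T = f (Suc s) * (P / q\<^sup>2)"
  proof -
    have "rho (Suc (Suc s)) * P = rho (Suc s) * (q\<^sup>2 * T)"
      unfolding P_def T_def z_def by (rule rho_Suc)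
    then have "f (Suc (Suc s)) * (q\<^sup>2 * T) = f (Suc s) * P"
      using fr[of "Suc s"] fr[of "Suc (Suc s)"] by algebra
    then show ?thesis by (simp add: field_simps)
  qed
  have down: "f s * V = f (Suc s) * (S / q\<^sup>2)"
  proof -
    have "q\<^sup>2 * ((1 - a * pt s) * (1 - b * pt s) * (1 - c * pt s) * (1 - d * pt s)) = S / q\<^sup>2"
    proof -
      have "q * pt s = z" by (simp add: z_def)
      then have "q - y * z = q * (1 - y * pt s)" for y :: complex
        by (simp add: right_diff_distrib)
      then have "S = q ^ 4 * ((1 - a * pt s) * (1 - b * pt s) * (1 - c * pt s) * (1 - d * pt s))"
        unfolding S_def by (simp add: power4_eq_xxxx)
      then show ?thesis by (simp add: power4_eq_xxxx power2_eq_square)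
    qed
    moreover have "q * pt s = z" by (simp add: z_def)
    moreover have "V = (a - z) * (b - z) * (c - z) * (d - z)"
      unfolding V_def by (simp add: algebra_simps)
    ultimately have "rho (Suc s) * V = rho s * (S / q\<^sup>2)"
      using rho_Suc[of s] by simp
    then show ?thesis
      using fr[of s] fr[of "Suc s"] by algebra
  qed
  have R1: "shift_factor z = T / W1" by (simp add: aw_shift_factor_def T_def W1_def)
  have R2: "shift_factor (1 / z) = V / W2" using aw_shift_factor_inverse[OF z0] by (simp add: V_def W2_def)
  have core: "P / (q\<^sup>2 * W1) - shift_factor z + S / (q\<^sup>2 * W2) - shift_factor (1 / z) = (q - 1) * (1 - g / q\<^sup>2)"
    unfolding P_def S_def W1_def W2_def by (rule aw_eigen_core[OF q_nonzero z0 zg])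
  have "shift_factor z * f (Suc (Suc s)) = f (Suc s) * (P / (q\<^sup>2 * W1))"
    using up unfolding R1 by (simp add: mult.commute)
  moreover have "shift_factor (1 / z) * f s = f (Suc s) * (S / (q\<^sup>2 * W2))"
    using down unfolding R2 by (simp add: mult.commute)
  ultimately show ?thesis
    unfolding core[symmetric] f_def[symmetric] by (simp add: algebra_simps)
qed

lemma pt_periodic: "pt (N + s) = pt s"
  by (simp add: power_add q_N)

text \<open>By periodicity interpolation at the \<open>N\<close> nodes gives a representation valid at all indices.\<close>

lemma inverse_rho_expansion:
  obtains e where "\<And>s. inverse (rho s) = (\<Sum>k<N. e k * basis (pt s) k)"
proof -
  define p where "p = lagrange_poly node N (\<lambda>s. inverse (rho s))"
  have p: "poly p (node s) = inverse (rho s)" if "s < N" for s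
    unfolding p_def by (rule poly_lagrange_poly[OF inj_node that])
  have "coeff p i = 0" if "i \<ge> N" for i
    using degree_lagrange_poly[of N node] N_pos that by (intro coeff_eq_0) (auto simp: p_def intro: less_le_trans)
  then obtain e where e: "p = (\<Sum>k<N. smult (e k) (pbasis a q k))"
    using pbasis_expansion[of a q N p] by auto
  have small: "inverse (rho s) = (\<Sum>k<N. e k * basis (pt s) k)" if "s < N" for s
    using p[OF that] unfolding e by (simp only: poly_sum poly_smult) (simp add: poly_pbasis del: inverse_mult_distrib)
  have "inverse (rho s) = (\<Sum>k<N. e k * basis (pt s) k)" for s
  proof (induction s rule: less_induct)
    case (less s)
    show ?case
    proof (cases "s < N")
      case False
      then have "rho s = rho (s - N)" "pt s = pt (s - N)"
        using rho_periodic[of "s - N"] pt_periodic[of "s - N"] by simp_all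
      moreover have "s - N < s" using False N_pos by simp
      ultimately show ?thesis using less[of "s - N"] by metis
    qed (rule small)
  qed
  then show ?thesis by (rule that)
qed

lemma basis_independent_at_nodes:
  assumes "\<And>s. s < N \<Longrightarrow> (\<Sum>k<N. e k * basis (pt s) k) = 0" "k < N"
  shows "e k = 0"
proof -
  let ?p = "\<Sum>k<N. smult (e k) (pbasis a q k)"
  have "?p = 0"
  proof (rule poly_eqI_degree[where A = "node ` {..<N}"])
    have card: "card (node ` {..<N}) = N" using inj_node by (simp add: card_image)
    then show "card (node ` {..<N}) > degree (0 :: complex poly)" using N_pos by simp
    have "degree ?p \<le> N - 1"
    proof (rule degree_sum_le)
      fix k assume "k \<in> {..<N}"
      then show "degree (smult (e k) (pbasis a q k)) \<le> N - 1"
        using degree_smult_le[of "e k" "pbasis a q k"] degree_pbasis[of a q k] by simp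
    qed simp
    then show "card (node ` {..<N}) > degree ?p" using card N_pos by linarith
    fix y assume "y \<in> node ` {..<N}"
    then show "poly ?p y = poly 0 y"
      using assms(1) by (auto simp: poly_sum poly_pbasis simp del: inverse_mult_distrib)
  qed
  then show ?thesis using assms(2) by (intro pbasis_independent[of a q e N]) auto
qed

text \<open>Up to sign the off-diagonal entry of \<open>D\<close>. For \<open>k = 0\<close> the truncated exponent \<open>k - 1\<close> is harmless, since the first
  factor vanishes.\<close>

definition lowering :: "nat \<Rightarrow> complex" where
  "lowering k = (1 / q ^ k - 1)
     * ((1 - a * b * q ^ (k - 1)) * (1 - a * c * q ^ (k - 1)) * (1 - a * d * q ^ (k - 1)))"

lemma difference_basis_at:
  fixes s
  defines "z \<equiv> pt (Suc s)"
  shows "shift_factor z * (basis (q * z) k - basis z k) + shift_factor (1 / z) * (basis (z / q) k - basis z k)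
    = aw_eigen g q k * basis z k - lowering k * basis z (k - 1)"
proof (cases k)
  case 0
  then show ?thesis by (simp add: aw_eigen_def lowering_def)
next
  case (Suc m)
  have "z \<noteq> 0" "z\<^sup>2 \<noteq> 1" "q * z\<^sup>2 \<noteq> 1" "z\<^sup>2 \<noteq> q"
    using pt_generic(1,2)[of "Suc s"] pt_generic(3)[of s] by (auto simp: z_def)
  from aw_difference_basis[OF q_nonzero this, of a b c d m] show ?thesis
    by (simp only: Suc lowering_def diff_Suc_1)
qed

text \<open>Comparison of coefficients in the eigenvalue equation. Functions on the nodes have unique
  coefficients, and since \<open>D\<close> is bidiagonal each coefficient determines the next one.\<close>

lemma expansion_coeff_step:
  assumes e: "\<And>s. inverse (rho s) = (\<Sum>k<N. e k * basis (pt s) k)" and k: "Suc k < N"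
  shows "e k * (aw_eigen g q k - (q - 1) * (1 - g / q\<^sup>2)) = e (Suc k) * lowering (Suc k)"
proof -
  define l where "l = (q - 1) * (1 - g / q\<^sup>2)"
  define h where "h k = (if Suc k < N then e (Suc k) * lowering (Suc k) else 0)" for k
  have zero: "(\<Sum>k<N. (e k * (aw_eigen g q k - l) - h k) * basis (pt (Suc s)) k) = 0" for s
  proof -
    define z where "z = pt (Suc s)"
    have f1: "inverse (rho (Suc s)) = (\<Sum>k<N. e k * basis z k)"
      unfolding z_def by (rule e)
    have f2: "inverse (rho (Suc (Suc s))) = (\<Sum>k<N. e k * basis (q * z) k)"
      using e[of "Suc (Suc s)"] by (simp add: z_def mult_ac)
    have f0: "inverse (rho s) = (\<Sum>k<N. e k * basis (z / q) k)"
      using e[of s] by (simp add: z_def)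
    have shift: "(\<Sum>k<N. e k * lowering k * basis z (k - 1)) = (\<Sum>k<N. h k * basis z k)"
    proof -
      obtain M where M: "N = Suc M" using N_pos by (cases N) auto
      have "(\<Sum>k<N. e k * lowering k * basis z (k - 1)) = (\<Sum>k<M. e (Suc k) * lowering (Suc k) * basis z k)"
        unfolding M sum.lessThan_Suc_shift by (simp add: lowering_def)
      also have "\<dots> = (\<Sum>k<M. h k * basis z k)"
        by (rule sum.cong) (auto simp: h_def M)
      also have "\<dots> = (\<Sum>k<N. h k * basis z k)"
        by (simp add: M h_def)
      finally show ?thesis .
    qed
    have "l * (\<Sum>k<N. e k * basis z k)
       = shift_factor z * ((\<Sum>k<N. e k * basis (q * z) k) - (\<Sum>k<N. e k * basis z k))
       + shift_factor (1 / z) * ((\<Sum>k<N. e k * basis (z / q) k) - (\<Sum>k<N. e k * basis z k))"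
      using inverse_rho_eigen[of s] unfolding f0 f1 f2 l_def z_def[symmetric] by simp
    also have "\<dots> = (\<Sum>k<N. e k * (shift_factor z * (basis (q * z) k - basis z k)
         + shift_factor (1 / z) * (basis (z / q) k - basis z k)))"
      unfolding sum_subtractf[symmetric] sum_distrib_left sum.distrib[symmetric]
      by (rule sum.cong) (simp_all add: algebra_simps)
    also have "\<dots> = (\<Sum>k<N. e k * aw_eigen g q k * basis z k) - (\<Sum>k<N. e k * lowering k * basis z (k - 1))"
      unfolding z_def difference_basis_at sum_subtractf[symmetric]
      by (rule sum.cong) (simp_all only: right_diff_distrib mult.assoc)
    finally have "(\<Sum>k<N. e k * aw_eigen g q k * basis z k) - (\<Sum>k<N. h k * basis z k)
      - l * (\<Sum>k<N. e k * basis z k) = 0"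
      unfolding shift by simp
    moreover have "(\<Sum>k<N. e k * aw_eigen g q k * basis z k) - (\<Sum>k<N. h k * basis z k)
      - l * (\<Sum>k<N. e k * basis z k) = (\<Sum>k<N. (e k * (aw_eigen g q k - l) - h k) * basis z k)"
      unfolding sum_distrib_left sum_subtractf[symmetric]
      by (rule sum.cong) (simp_all add: algebra_simps)
    ultimately show ?thesis
      unfolding z_def by simp
  qed
  have "e k * (aw_eigen g q k - l) - h k = 0"
  proof (rule basis_independent_at_nodes[where e = "\<lambda>k. e k * (aw_eigen g q k - l) - h k"])
    fix s
    have "pt (Suc (N - 1 + s)) = pt s" using pt_periodic[of s] N_pos by simp
    then show "(\<Sum>k<N. (e k * (aw_eigen g q k - l) - h k) * basis (pt s) k) = 0"
      using zero[of "N - 1 + s"] by (simp only:)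
  qed (use k in simp)
  then show ?thesis using k by (simp add: h_def l_def)
qed

lemma expansion_coeff:
  assumes e: "\<And>s. inverse (rho s) = (\<Sum>k<N. e k * basis (pt s) k)" and "k < N"
  shows "e k = e 0 * C (q ^ (N - 1)) k"
  using assms(2)
proof (induction k)
  case (Suc k)
  define K where "K = q ^ k"
  define D where "D = (1 - a * b * K) * (1 - a * c * K) * (1 - a * d * K)"
  have K: "K \<noteq> 0" by (simp add: K_def)
  have den: "1 - a * b * K \<noteq> 0 \<and> 1 - a * c * K \<noteq> 0 \<and> 1 - a * d * K \<noteq> 0 \<and> 1 - K * q \<noteq> 0"
    unfolding K_def by (rule denominators_nonzero) (use Suc.prems in simp)
  then have D: "D \<noteq> 0" "1 - K * q \<noteq> 0" by (simp_all add: D_def)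
  have "e k * ((1 - K * q) / K * (1 - g * K / q\<^sup>2)) = e (Suc k) * ((1 - K * q) / (K * q) * D)"
  proof -
    have "aw_eigen g q k - (q - 1) * (1 - g / q\<^sup>2) = (1 - K * q) / K * (1 - g * K / q\<^sup>2)"
      using K unfolding aw_eigen_def K_def[symmetric]
      by (simp add: field_simps power2_eq_square)
    moreover have "lowering (Suc k) = (1 - K * q) / (K * q) * D"
      using K by (simp add: lowering_def D_def K_def field_simps)
    ultimately show ?thesis using expansion_coeff_step[OF e Suc.prems] by simp
  qed
  note step = this
  have "(1 - K * q) * (e (Suc k) * D) = K * q * (e (Suc k) * ((1 - K * q) / (K * q) * D))"
    using K by simp
  also have "\<dots> = (1 - K * q) * (e k * (q * (1 - g * K / q\<^sup>2)))"
  proof -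
    have "K * q * (y * ((1 - K * q) / K * w)) = (1 - K * q) * (y * (q * w))" for y w
      using K by simp
    then show ?thesis unfolding step[symmetric] .
  qed
  finally have "(1 - K * q) * (e (Suc k) * D) = (1 - K * q) * (e k * (q * (1 - g * K / q\<^sup>2)))" .
  then have "e (Suc k) * D = e k * (q * (1 - g * K / q\<^sup>2))"
    using D(2) by simp
  then have "e (Suc k) = e k * (q * (1 - g * K / q\<^sup>2) / D)"
    using D(1) by (simp add: field_simps)
  moreover have "C (q ^ (N - 1)) (Suc k) = C (q ^ (N - 1)) k * (q * (1 - g * K / q\<^sup>2) / D)"
  proof -
    have p1: "g * q ^ (N - 1) / q = g / q\<^sup>2"
      unfolding q_pow_pred by (simp add: power2_eq_square)
    have p2: "1 / q ^ (N - 1) = q" unfolding q_pow_pred by simp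
    have p3: "g / q\<^sup>2 * K = g * K / q\<^sup>2" by simp
    have regroup: "u * (1 - K * q) * (v * w) * (p * q) / (x1 * y1 * (x2 * y2) * (x3 * y3) * (x4 * (1 - K * q)))
       = u * v * p / (x1 * x2 * x3 * x4) * (q * w / (y1 * y2 * y3))" for u v w p x1 x2 x3 x4 y1 y2 y3
      using D(2) by (simp add: mult_ac)
    show ?thesis
      unfolding aw_coeff_def qpoch_Suc D_def power_Suc2 K_def[symmetric] p1 p2 p3 mult.commute[of q K]
      by (rule regroup)
  qed
  ultimately show ?case using Suc by simp
qed simp

text \<open>The \<open>\<^sub>4\<phi>\<^sub>3\<close> value at the \<open>s\<close>-th node, i.e. the polynomial of degree \<open>N - 1\<close> up to a constant.\<close>

definition penultimate :: "nat \<Rightarrow> complex" where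
  "penultimate s = (\<Sum>k<N. C (q ^ (N - 1)) k * basis (pt s) k)"

text \<open>The function \<open>1/\<rho>\<close> on the nodes has the same coefficients as the \<open>\<^sub>4\<phi>\<^sub>3\<close> polynomial of degree \<open>N - 1\<close>, up to
  a scalar. The scalar and the value at the first node are nonzero because their product is \<open>1/\<rho>(0) = 1\<close>.\<close>

lemma penultimate_rho: "penultimate s * rho s = penultimate 0" and penultimate_0_nonzero: "penultimate 0 \<noteq> 0"
proof -
  obtain e where e: "\<And>s. inverse (rho s) = (\<Sum>k<N. e k * basis (pt s) k)"
    using inverse_rho_expansion by blast
  have et: "inverse (rho s) = e 0 * penultimate s" for s
    unfolding e penultimate_def sum_distrib_left
  proof (rule sum.cong[OF refl])
    fix k assume "k \<in> {..<N}"
    then have "e k = e 0 * C (q ^ (N - 1)) k"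
      by (intro expansion_coeff[OF e]) simp
    then show "e k * basis (pt s) k = e 0 * (C (q ^ (N - 1)) k * basis (pt s) k)"
      by (simp only: mult.assoc)
  qed
  have "e 0 * penultimate 0 = 1" using et[of 0] by simp
  then show "penultimate 0 \<noteq> 0" by auto
  have "e 0 * (penultimate s * rho s) = inverse (rho s) * rho s"
    unfolding et by (simp only: mult.assoc)
  also have "\<dots> = e 0 * penultimate 0"
    using rho_nonzero[of s] \<open>e 0 * penultimate 0 = 1\<close> by simp
  finally have "e 0 * (penultimate s * rho s) = e 0 * penultimate 0" .
  moreover have "e 0 \<noteq> 0" using \<open>e 0 * penultimate 0 = 1\<close> by auto
  ultimately show "penultimate s * rho s = penultimate 0" by (simp only: mult_cancel_left simp_thms)
qed

lemma numerator_at_node: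
  "continuant (aw_v a b c d q) (aw_u a b c d q) (node s) (N - 1) 1 * penultimate s = (\<Prod>j<N-1. xi (Suc j))"
proof -
  define M where "M = N - 1"
  have N: "N = Suc M" using N_pos by (simp add: M_def)
  have "continuant (aw_v a b c d q) (aw_u a b c d q) (node s) M 1 * X (node s) M 0
     = (\<Prod>j<M. aw_u a b c d q (Suc j))"
  proof (cases M)
    case (Suc n)
    then show ?thesis
      using continuant_wronskian[of "aw_v a b c d q" "aw_u a b c d q" "node s" n] X_N_node[of s]
      by (simp add: N del: continuant.simps inverse_mult_distrib)
  qed simp
  also have "(\<Prod>j<M. aw_u a b c d q (Suc j)) = (\<Prod>j<M. xi (Suc j)) * (\<Prod>j<M. eta j)"
    by (simp add: aw_u_def prod.distrib)
  also have "X (node s) M 0 = (\<Prod>j<M. eta j) * penultimate s"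
    unfolding penultimate_def M_def[symmetric] by (rule X_hypergeometric) (simp_all add: N)
  finally have "(\<Prod>j<M. eta j) * (continuant (aw_v a b c d q) (aw_u a b c d q) (node s) M 1 * penultimate s)
     = (\<Prod>j<M. eta j) * (\<Prod>j<M. xi (Suc j))" by (simp only: mult_ac)
  moreover have "(\<Prod>j<M. eta j) \<noteq> 0"
  proof -
    have "(g / q) ^ N \<noteq> 1" using quad q_N by (simp add: power_divide)
    then show ?thesis
      unfolding prod_aw_eta[OF q_nonzero] by (simp add: qpoch_nonzero pair)
  qed
  ultimately show ?thesis by (simp add: M_def)
qed

text \<open>Products over \<open>N - 1\<close> consecutive powers of \<open>q\<close> are those over a full period with one factor removed;
  this is the origin of the \<open>N\<close>-th powers and of the factors with \<open>1/q\<close> in \<open>\<kappa>\<close>. The factor \<open>N\<close> of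
  \<open>(q;q)\<^sub>N\<^sub>-\<^sub>1\<close> cancels against the one in the derivative of the polynomial of degree \<open>N\<close>.\<close>

lemma prod_xi_closed:
  "(\<Prod>j<N-1. xi (Suc j)) * (r - inverse r) / (of_nat N * (r ^ N - inverse (r ^ N)))
     = aw_kappa a b c d q N r"
proof -
  have qp: "qpoch y q (N - 1) = (1 - y ^ N) / (1 - y / q)" if "y ^ N \<noteq> 1" for y
  proof -
    have "Suc (N - 1) = N" using N_pos by simp
    then have "qpoch y q (N - 1) * (1 - y / q) = 1 - y ^ N"
      using qpoch_Suc[of y q "N - 1"] qpoch_N[of y] unfolding q_pow_pred by simp
    moreover have "1 - y / q \<noteq> 0"
      using one_minus_nonzero[OF that, of "1 / q"] q_N by (simp add: power_divide)
    ultimately show ?thesis by (simp add: field_simps)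
  qed
  have gq: "(g / q) ^ N = g ^ N" using q_N by (simp add: power_divide)
  have "qpoch g q (2 * (N - 1)) = qpoch g q (N - 1) * qpoch (g / q) q (N - 1)"
    unfolding mult_2 qpoch_add q_pow_pred by simp
  also have "\<dots> = (1 - g ^ N)\<^sup>2 / ((1 - g / q) * (1 - g / q\<^sup>2))"
    using qp[of g] qp[of "g / q"] quad gq by (simp add: power2_eq_square)
  finally have G: "qpoch g q (2 * (N - 1)) = (1 - g ^ N)\<^sup>2 / ((1 - g / q) * (1 - g / q\<^sup>2))" .
  show ?thesis
    unfolding prod_aw_xi[OF q_nonzero] G qpoch_q_pred qp[OF pair(4)] qp[OF pair(5)] qp[OF pair(6)]
      aw_kappa_def Let_def
    using N_pos by (simp add: mult_ac)
qed

lemma r_generic: "r - inverse r \<noteq> 0" "r ^ N - inverse (r ^ N) \<noteq> 0" "1 - r\<^sup>2 \<noteq> 0"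
proof -
  show r: "1 - r\<^sup>2 \<noteq> 0" using pt_generic(1)[of 0] by simp
  then show "r - inverse r \<noteq> 0" by (simp add: field_simps power2_eq_square)
  show "r ^ N - inverse (r ^ N) \<noteq> 0" using r2 by (simp add: field_simps power2_eq_square)
qed

lemma residue_at_node:
  "continuant (aw_v a b c d q) (aw_u a b c d q) (node s) (N - 1) 1
     / poly (pderiv (continuant_poly (aw_v a b c d q) (aw_u a b c d q) N 0)) (node s)
   = aw_kappa a b c d q N r / penultimate 0 * (rho s * (pt s - inverse (pt s)) / (r - inverse r))"
proof -
  define D where "D = poly (pderiv (continuant_poly (aw_v a b c d q) (aw_u a b c d q) N 0)) (node s)"
  define Y where "Y = continuant (aw_v a b c d q) (aw_u a b c d q) (node s) (N - 1) 1"
  define H where "H = (\<Prod>j<N-1. xi (Suc j))"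
  define w where "w = pt s - inverse (pt s)"
  define W where "W = of_nat N * (r ^ N - inverse (r ^ N))"
  define v where "v = r - inverse r"
  have D: "D * w = W" using X_N_deriv_node[of s] by (simp only: D_def w_def W_def)
  have W: "W \<noteq> 0" using r_generic N_pos by (simp add: W_def)
  have v: "v \<noteq> 0" using r_generic by (simp add: v_def)
  have t: "penultimate s \<noteq> 0" using penultimate_rho[of s] penultimate_0_nonzero by auto
  have Y: "Y = H / penultimate s" using numerator_at_node[of s] t by (simp add: Y_def H_def field_simps)
  have kap: "aw_kappa a b c d q N r = H * v / W"
    using prod_xi_closed by (simp add: H_def W_def v_def)
  have w: "w \<noteq> 0" "D = W / w" using D W by (auto simp: field_simps)
  show ?thesis
    unfolding D_def[symmetric] Y_def[symmetric] w_def[symmetric] v_def[symmetric] kap Y w(2) penultimate_rho[of s, symmetric]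
    using W v t w(1) rho_nonzero[of s] by (simp add: field_simps)
qed

end

section \<open>The very-well-poised series\<close>

lemma powi_neg_pred:
  assumes "N \<ge> 1"
  shows "(y::'a::field) powi (- (int N - 1)) = inverse (y ^ (N - 1))"
proof -
  have "- (int N - 1) = - int (N - 1)" using assms by simp
  then show ?thesis by (simp only: power_int_minus power_int_of_nat)
qed

lemma qpoch_shift_ratio:
  fixes q :: "'a::field"
  assumes "qpoch (y * q) q k \<noteq> 0" "1 - y * q ^ k \<noteq> 0"
  shows "qpoch y q k / qpoch (y * q) q k = (1 - y) / (1 - y * q ^ k)"
proof -
  have "qpoch y q k * (1 - y * q ^ k) = (1 - y) * qpoch (y * q) q k"
    using qpoch_Suc[of y q k] qpoch_rec[of y q k] by simp
  then show ?thesis using assms by (simp add: field_simps)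
qed

lemma qpoch_rf_nonzero:
  assumes "y \<noteq> 0" "q \<noteq> 0"
  shows "qpoch (rf_const y * rf_var) (rf_const q) k \<noteq> 0" "qpoch (rf_const y / rf_var) (rf_const q) k \<noteq> 0"
proof -
  have "rf_const y * rf_var * rf_const q ^ j \<noteq> 1" for j
    using rf_affine_nonzero(1)[of "y * q ^ j"] assms by (simp add: mult_ac)
  then show "qpoch (rf_const y * rf_var) (rf_const q) k \<noteq> 0" by (auto simp: qpoch_eq_0_iff)
  have "rf_const y / rf_var * rf_const q ^ j \<noteq> 1" for j
    using rf_affine_nonzero(2)[of "y * q ^ j"] assms by (simp add: mult_ac)
  then show "qpoch (rf_const y / rf_var) (rf_const q) k \<noteq> 0" by (auto simp: qpoch_eq_0_iff)
qed

lemma rf_quadratic_factor: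
  assumes "y \<noteq> 0"
  shows "(1 - rf_const y * rf_var) * (1 - rf_const y / rf_var)
    = - rf_const y * (rf_var + inverse rf_var - rf_const (y + inverse y))"
proof -
  have "rf_var \<noteq> 0" by (simp add: rf_var_def)
  moreover have "rf_const y \<noteq> 0" using assms by simp
  ultimately show ?thesis by (simp add: field_simps)
qed

text \<open>The factors that contain \<open>t\<close> telescope to a single simple pole at \<open>x = r q\<^sup>k + 1/(r q\<^sup>k)\<close>, so the
  \<open>\<^sub>9\<phi>\<^sub>8\<close> series is itself a partial fraction decomposition.\<close>

lemma rf_qpoch_ratio:
  assumes "r \<noteq> 0" "q \<noteq> 0"
  shows "qpoch (rf_const r * rf_var) (rf_const q) k * qpoch (rf_const r / rf_var) (rf_const q) k
     / (qpoch (rf_const (q * r) * rf_var) (rf_const q) k * qpoch (rf_const (q * r) / rf_var) (rf_const q) k)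
    = (rf_var + inverse rf_var - rf_const (r + inverse r))
      / (rf_const (q ^ k) * (rf_var + inverse rf_var - rf_const (r * q ^ k + inverse (r * q ^ k))))"
proof -
  have qr: "q * r \<noteq> 0" "r * q ^ k \<noteq> 0" using assms by simp_all
  have e1: "rf_const (q * r) * rf_var = rf_const r * rf_var * rf_const q"
    and e2: "rf_const (q * r) / rf_var = rf_const r / rf_var * rf_const q"
    by simp_all
  have e3: "rf_const r * rf_var * rf_const q ^ k = rf_const (r * q ^ k) * rf_var"
    and e4: "rf_const r / rf_var * rf_const q ^ k = rf_const (r * q ^ k) / rf_var"
    by simp_all
  have a1: "qpoch (rf_const r * rf_var) (rf_const q) k / qpoch (rf_const (q * r) * rf_var) (rf_const q) k
     = (1 - rf_const r * rf_var) / (1 - rf_const (r * q ^ k) * rf_var)"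
    using qpoch_shift_ratio[of "rf_const r * rf_var" "rf_const q" k] qpoch_rf_nonzero(1)[OF qr(1) assms(2), of k]
      rf_affine_nonzero(1)[OF qr(2)] unfolding e1 e3 by blast
  have a2: "qpoch (rf_const r / rf_var) (rf_const q) k / qpoch (rf_const (q * r) / rf_var) (rf_const q) k
     = (1 - rf_const r / rf_var) / (1 - rf_const (r * q ^ k) / rf_var)"
    using qpoch_shift_ratio[of "rf_const r / rf_var" "rf_const q" k] qpoch_rf_nonzero(2)[OF qr(1) assms(2), of k]
      rf_affine_nonzero(2)[OF qr(2)] unfolding e2 e4 by blast
  have "qpoch (rf_const r * rf_var) (rf_const q) k * qpoch (rf_const r / rf_var) (rf_const q) k
     / (qpoch (rf_const (q * r) * rf_var) (rf_const q) k * qpoch (rf_const (q * r) / rf_var) (rf_const q) k)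
    = ((1 - rf_const r * rf_var) * (1 - rf_const r / rf_var))
      / ((1 - rf_const (r * q ^ k) * rf_var) * (1 - rf_const (r * q ^ k) / rf_var))"
    unfolding times_divide_times_eq[symmetric] a1 a2 ..
  also have "\<dots> = (rf_const r * (rf_var + inverse rf_var - rf_const (r + inverse r)))
      / (rf_const r * (rf_const (q ^ k) * (rf_var + inverse rf_var - rf_const (r * q ^ k + inverse (r * q ^ k)))))"
    unfolding rf_quadratic_factor[OF assms(1)] rf_quadratic_factor[OF qr(2)]
    unfolding rf_const_mult by (simp only: mult_minus_left minus_divide_divide mult.assoc)
  also have "\<dots> = (rf_var + inverse rf_var - rf_const (r + inverse r))
      / (rf_const (q ^ k) * (rf_var + inverse rf_var - rf_const (r * q ^ k + inverse (r * q ^ k))))"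
    using assms by (intro mult_divide_mult_cancel_left) simp
  finally show ?thesis .
qed

context aw_root_of_unity
begin

lemma well_poised_factor:
  "qpoch (q * r) q k * qpoch (- q * r) q k / (qpoch r q k * qpoch (- r) q k) = (1 - (pt k)\<^sup>2) / (1 - r\<^sup>2)"
proof -
  have nz: "qpoch y q k \<noteq> 0" if "y\<^sup>2 = r\<^sup>2" for y
  proof -
    have "y ^ N \<noteq> 1"
    proof
      assume "y ^ N = 1"
      then have "(y\<^sup>2) ^ N = 1" by (metis mult.commute power_mult power_one)
      then show False using r2 that by (metis mult.commute power_mult)
    qed
    then show ?thesis by (rule qpoch_nonzero)
  qed
  have r1: "qpoch (q * y) q k * (1 - y) = qpoch y q k * (1 - y * q ^ k)" for y
    using qpoch_Suc[of y q k] qpoch_rec[of y q k] by (simp add: mult_ac)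
  have "qpoch (q * r) q k * qpoch (- q * r) q k * (1 - r\<^sup>2)
     = (qpoch (q * r) q k * (1 - r)) * (qpoch (q * (- r)) q k * (1 - (- r)))"
    by (simp add: algebra_simps power2_eq_square)
  also have "\<dots> = qpoch r q k * qpoch (- r) q k * (1 - (pt k)\<^sup>2)"
    unfolding r1 by (simp add: algebra_simps power2_eq_square)
  finally show ?thesis
    using nz[of r] nz[of "- r"] r_generic(3) by (simp add: field_simps)
qed

lemma weight_factor:
  "(1 - (pt k)\<^sup>2) / (1 - r\<^sup>2) = q ^ k * ((pt k - inverse (pt k)) / (r - inverse r))"
proof -
  have "1 - (pt k)\<^sup>2 = - pt k * (pt k - inverse (pt k))" "1 - r\<^sup>2 = - r * (r - inverse r)"
    by (simp_all add: field_simps power2_eq_square)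
  then show ?thesis using r_generic(1) by simp
qed

lemma nine_phi_eight_term:
  assumes k: "k < N"
  shows "qpoch (rf_const q powi (- (int N - 1))) (rf_const q) k
      * (\<Prod>\<alpha>\<leftarrow>[rf_const r * rf_var, rf_const r / rf_var, rf_const (q * r), rf_const (- q * r),
          rf_const (a * r), rf_const (b * r), rf_const (c * r), rf_const (d * r)]. qpoch \<alpha> (rf_const q) k)
      / (qpoch (rf_const q) (rf_const q) k
      * (\<Prod>\<beta>\<leftarrow>[rf_const (q * r) / rf_var, rf_const (q * r) * rf_var, rf_const r, rf_const (- r),
          rf_const (q * r / a), rf_const (q * r / b), rf_const (q * r / c), rf_const (q * r / d)].
            qpoch \<beta> (rf_const q) k)) * rf_const (q\<^sup>2 / g) ^ k
    = (rf_var + inverse rf_var - rf_const (r + inverse r)) / (rf_var + inverse rf_var - rf_const (node k))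
      * rf_const (rho k * (pt k - inverse (pt k)) / (r - inverse r))"
    (is "?L = _")
proof -
  have "rf_const q powi (- (int N - 1)) = rf_const q"
  proof -
    have "rf_const q powi (- (int N - 1)) = inverse (rf_const q ^ (N - 1))"
      by (rule powi_neg_pred[OF N_pos])
    also have "\<dots> = rf_const (inverse (q ^ (N - 1)))" by simp
    also have "inverse (q ^ (N - 1)) = q" unfolding q_pow_pred by simp
    finally show ?thesis .
  qed
  note pw = this
  define Z where "Z = qpoch (rf_const r * rf_var) (rf_const q) k * qpoch (rf_const r / rf_var) (rf_const q) k
     / (qpoch (rf_const (q * r) * rf_var) (rf_const q) k * qpoch (rf_const (q * r) / rf_var) (rf_const q) k)"
  have qq: "qpoch (rf_const q) (rf_const q) k \<noteq> 0"
    unfolding rf_const_qpoch using qpoch_q_nonzero[OF k] by simp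
  define S where "S = qpoch (q * r) q k * qpoch (- q * r) q k / (qpoch r q k * qpoch (- r) q k)"
  have regroup: "p * (a1 * (a2 * (b1 * (b2 * (b3 * (b4 * (b5 * (b6 * 1)))))))) /
      (p * (c1 * (c2 * (d1 * (d2 * (d3 * (d4 * (d5 * (d6 * 1))))))))) * z
     = a1 * a2 / (c2 * c1) * (b1 * b2 / (d1 * d2) * (b3 * b4 * b5 * b6 / (d3 * d4 * d5 * d6) * z))"
    if "p \<noteq> 0" for p a1 a2 b1 b2 b3 b4 b5 b6 c1 c2 d1 d2 d3 d4 d5 d6 z :: "complex poly fract"
    using that by (simp add: mult_ac)
  have "?L = Z * rf_const (S * rho k)"
    unfolding pw list.map prod_list.Cons prod_list.Nil regroup[OF qq] Z_def
    unfolding rf_const_qpoch S_def rho_def rf_const_mult[of _ "rho k"] rf_const_mult[of "x / y" "z ^ k" for x y z]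
    unfolding rf_const_mult[symmetric] rf_const_divide[symmetric] rf_const_power[symmetric] ..
  also have "S * rho k = q ^ k * (rho k * (pt k - inverse (pt k)) / (r - inverse r))"
    unfolding S_def well_poised_factor weight_factor by simp
  also have "Z * rf_const (q ^ k * (rho k * (pt k - inverse (pt k)) / (r - inverse r)))
    = (rf_var + inverse rf_var - rf_const (r + inverse r)) / (rf_var + inverse rf_var - rf_const (node k))
      * rf_const (rho k * (pt k - inverse (pt k)) / (r - inverse r))"
  proof -
    have "u / (rf_const (q ^ k) * w) * (rf_const (q ^ k) * y) = u / w * y" for u w y
      by simp
    then show ?thesis
      unfolding Z_def rf_qpoch_ratio[OF nz(5) q_nonzero] rf_const_mult[of "q ^ k"] .
  qed
  finally show ?thesis .
qed

end

section \<open>The representation of the continued fraction\<close>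

lemma primitive_root_exp:
  fixes N :: nat and M :: int
  assumes N: "N \<ge> 1" and cop: "coprime M (int N)"
    and q: "q = exp (2 * of_real pi * \<i> * of_int M / of_nat N)"
  shows "primitive_root N q"
proof
  have pow: "q ^ k = cis (2 * pi * of_int M * of_nat k / of_nat N)" for k
  proof -
    have "q = cis (2 * pi * of_int M / of_nat N)"
      unfolding q cis_conv_exp by (rule arg_cong[where f = exp]) simp
    then show ?thesis by (simp add: DeMoivre mult_ac)
  qed
  show "N \<ge> 1" by (rule N)
  show "q ^ N = 1"
    using N cis_multiple_2pi[of "of_int M"] by (simp add: pow)
  fix k assume k: "0 < k" "k < N"
  show "q ^ k \<noteq> 1"
  proof
    assume "q ^ k = 1"
    then have "cos (2 * pi * of_int M * of_nat k / of_nat N) = 1"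
      by (simp add: pow complex_eq_iff)
    then obtain n :: int where "2 * pi * of_int M * of_nat k / of_nat N = of_int n * 2 * pi"
      by (auto simp: cos_one_2pi_int)
    then have "of_int M * of_nat k = (of_int n * of_nat N :: real)"
      using N by (simp add: field_simps)
    then have "real_of_int (M * int k) = real_of_int (n * int N)" by simp
    then have "M * int k = n * int N" by (simp only: of_int_eq_iff)
    then have "int N dvd M * int k" by simp
    then have "int N dvd int k"
      using cop by (simp add: coprime_commute coprime_dvd_mult_right_iff)
    then show False using k by (auto dest: dvd_imp_le)
  qed
qed

text \<open>The \<open>N\<close>-th roots of unity are the powers of \<open>q\<close>.\<close>

lemma (in primitive_root) pow_N_ne_1:
  assumes "\<forall>k::int. y \<noteq> q powi k"
  shows "y ^ N \<noteq> 1"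
proof
  assume "y ^ N = 1"
  then have "qpoch y q N = 0" by (simp add: qpoch_N)
  then obtain j where "y * q ^ j = 1" by (auto simp: qpoch_eq_0_iff)
  then have "y = q powi (- int j)"
    by (simp add: power_int_minus field_simps)
  then show False using assms by blast
qed

theorem mainTheorem1:
  fixes N :: nat and M :: int and a b c d g q r :: complex
    and t x :: "complex poly fract"
  assumes "N \<ge> 1" and "coprime M (int N)"
    and "q = exp (2 * of_real pi * \<i> * of_int M / of_nat N)"
    and "a \<noteq> 0" "b \<noteq> 0" "c \<noteq> 0" "d \<noteq> 0"
    and "g = a * b * c * d"
    and "\<forall>k::int. \<forall>p \<in> {g, a * b, a * c, a * d, b * c, b * d, c * d}. p \<noteq> q powi k"
    and "aw_E a b c d N \<noteq> 2" and "aw_E a b c d N \<noteq> - 2"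
    and "r \<noteq> 0" and "r ^ N + inverse (r ^ N) = aw_E a b c d N"
    and "t = rf_var" and "x = t + inverse t"
  shows "aw_F a b c d q N x =
    rf_const (aw_kappa a b c d q N r) / (x - rf_const r - 1 / rf_const r)
    * (qhyp_term N
         [rf_const r * t, rf_const r / t, rf_const (q * r), rf_const (- q * r),
          rf_const (a * r), rf_const (b * r), rf_const (c * r), rf_const (d * r)]
         [rf_const (q * r) / t, rf_const (q * r) * t, rf_const r, rf_const (- r),
          rf_const (q * r / a), rf_const (q * r / b), rf_const (q * r / c), rf_const (q * r / d)]
         (rf_const q) (rf_const (q\<^sup>2 / g))
       / rf_const (qhyp_term N [g * q powi (-2), a * r, a / r] [a * b, a * c, a * d] q q))"
proof -
  interpret primitive_root N q
    by (rule primitive_root_exp[OF assms(1-3)])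
  have ne: "p ^ N \<noteq> 1" if "p \<in> {g, a * b, a * c, a * d, b * c, b * d, c * d}" for p
    using assms(9) that by (intro pow_N_ne_1) blast
  interpret aw_root_of_unity N q a b c d r
  proof
    show "(r ^ N)\<^sup>2 \<noteq> 1"
    proof
      assume "(r ^ N)\<^sup>2 = 1"
      then have "r ^ N = 1 \<or> r ^ N = - 1" by (simp add: power2_eq_1_iff)
      then show False using assms(10,11,13) by auto
    qed
  qed (use assms ne in simp_all)
  have g: "g = a * b * c * d" by (rule assms(8))
  have x: "x = rf_var + inverse rf_var" by (simp add: assms(14,15))
  define \<kappa> where "\<kappa> = aw_kappa a b c d q N r"
  define x0 where "x0 = x - rf_const (r + inverse r)"
  define f where "f s = rho s * (pt s - inverse (pt s)) / (r - inverse r)" for s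
  have x0: "x0 \<noteq> 0" unfolding x0_def x by (rule rf_joukowski_nonconstant)
  have x0': "x - rf_const r - 1 / rf_const r = x0"
    by (simp add: x0_def inverse_eq_divide)
  have F: "aw_F a b c d q N x = (\<Sum>s<N. rf_const (\<kappa> / penultimate 0 * f s) / (x - rf_const (node s)))"
  proof -
    have "aw_F a b c d q N x
      = (\<Sum>s<N. rf_const (continuant (aw_v a b c d q) (aw_u a b c d q) (node s) (N - 1) 1
           / poly (pderiv (continuant_poly (aw_v a b c d q) (aw_u a b c d q) N 0)) (node s))
         / (x - rf_const (node s)))"
      unfolding aw_F_def x by (rule cfrac_partial_fractions[OF N_pos inj_node X_N_node])
    then show ?thesis unfolding residue_at_node f_def \<kappa>_def .
  qed
  have numer: "qhyp_term N
         [rf_const r * t, rf_const r / t, rf_const (q * r), rf_const (- q * r),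
          rf_const (a * r), rf_const (b * r), rf_const (c * r), rf_const (d * r)]
         [rf_const (q * r) / t, rf_const (q * r) * t, rf_const r, rf_const (- r),
          rf_const (q * r / a), rf_const (q * r / b), rf_const (q * r / c), rf_const (q * r / d)]
         (rf_const q) (rf_const (q\<^sup>2 / g))
     = (\<Sum>s<N. x0 / (x - rf_const (node s)) * rf_const (f s))"
    unfolding qhyp_term_def assms(14) g x0_def x f_def
    by (intro sum.cong refl nine_phi_eight_term) simp
  have denom: "qhyp_term N [g * q powi (-2), a * r, a / r] [a * b, a * c, a * d] q q = penultimate 0"
  proof -
    have pw: "q powi (- (int N - 1)) = 1 / q ^ (N - 1)"
      unfolding powi_neg_pred[OF N_pos] by (rule inverse_eq_divide)
    have gq: "g * q powi (-2) = g * q ^ (N - 1) / q"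
      unfolding q_pow_pred by (simp add: power_int_minus power2_eq_square divide_inverse)
    show ?thesis
      unfolding qhyp_term_def penultimate_def pw gq
      by (intro sum.cong refl)
        (simp add: aw_coeff_def aw_basis_def g mult_ac)
  qed
  have "aw_F a b c d q N x = rf_const (\<kappa> / penultimate 0) * (\<Sum>s<N. rf_const (f s) / (x - rf_const (node s)))"
    unfolding F sum_distrib_left rf_const_mult[of "\<kappa> / penultimate 0"] by simp
  also have "(\<Sum>s<N. rf_const (f s) / (x - rf_const (node s)))
     = (\<Sum>s<N. x0 / (x - rf_const (node s)) * rf_const (f s)) / x0"
    using x0 by (simp add: sum_divide_distrib)
  finally show ?thesis
    unfolding numer denom x0' \<kappa>_def[symmetric] by simp
qed

end
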